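(* Let $(Y_i)_{i\ge1}$ be independent random variables from one of the five non-Gaussian natural exponential families with quadratic variance function (NEF-QVF) described in the context (the same family for all $i$), and assume the condition corresponding to that family: - Binomial: $n_i\ge2$ for all $i$. - Poisson: $\inf_i\tau_i>0$, $\inf_i(\tau_i\theta_i)>0$, and $\sum_{i=1}^p\theta_i^3=O(p)$. - Negative-binomial: $\inf_i(n_ip_i)>0$ and $\sum_{i=1}^p\left(\frac{p_i}{1-p_i}\right)^4=O(p)$. - Gamma: $\inf_i\tau_i>0$ and $\sum_{i=1}^p\lambda_i^4=O(p)$. - GHS: $\inf_i\tau_i>0$ and $\sum_{i=1}^p\lambda_i^4=O(p)$. For each $p$ let $\hat{\boldsymbol\theta}^{\mathrm{PM}}$ be the parametric URE shrinkage estimator, and let $\hat{\boldsymbol\theta}^{\hat\gamma,\hat\mu}$, $\hat\theta_i^{\hat\gamma,\hat\mu}=\frac{\tau_i}{\tau_i+\hat\gamma}Y_i+\frac{\hat\gamma}{\tau_i+\hat\gamma}\hat\mu$, be any estimator with (random) $\hat\gamma\ge0$ and (random) $\hat\mu$ such that $|\hat\mu|\le\max_{1\le i\le p}|Y_i|$. Then for any $\varepsilon>0$ $$\lim_{p\to\infty}P\left(l_p(\boldsymbol\theta,\hat{\boldsymbol\theta}^{\mathrm{PM}})\ge l_p(\boldsymbol\theta,\hat{\boldsymbol\theta}^{\hat\gamma,\hat\mu})+\varepsilon\right)=0$$ and $$\limsup_{p\to\infty}\left[R_p(\boldsymbol\theta,\hat{\boldsymbol\theta}^{\mathrm{PM}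})-R_p(\boldsymbol\theta,\hat{\boldsymbol\theta}^{\hat\gamma,\hat\mu})\right]\le0.$$
   Context: Families (in each case $E(Y_i)=\theta_i$ and $\mathrm{Var}(Y_i)=V(\theta_i)/\tau_i$ with $V(\theta)=\nu_0+\nu_1\theta+\nu_2\theta^2$; all parameters are deterministic sequences; $\tau_i>0$ known): - Binomial: $n_iY_i\sim\mathrm{Bin}(n_i,p_i)$, $n_i$ a positive integer, $p_i\in(0,1)$; $\tau_i=n_i$, $\theta_i=p_i$, $(\nu_0,\nu_1,\nu_2)=(0,1,-1)$, $\Theta=[0,1]$. - Poisson: $\tau_iY_i\sim\mathrm{Poisson}(\tau_i\theta_i)$, $\theta_i>0$; $(\nu_0,\nu_1,\nu_2)=(0,1,0)$, $\Theta=[0,\infty)$. - Negative-binomial: $n_iY_i\sim\mathrm{NBin}(n_i,p_i)$, i.e. $P(n_iY_i=k)=\binom{n_i+k-1}{k}p_i^k(1-p_i)^{n_i}$, $k=0,1,2,\dots$, $n_i$ a positive integer, $p_i\in(0,1)$; $\tau_i=n_i$, $\theta_i=\frac{p_i}{1-p_i}$, $(\nu_0,\nu_1,\nu_2)=(0,1,1)$, $\Theta=[0,\infty)$. - Gamma: $\tau_iY_i\sim\Gamma(\tau_i\alpha,\lambda_i)$ (shape $\tau_i\alpha$, scale $\lambda_i>0$), $\alpha>0$ a known constant; $\theta_i=\alpha\lambda_i$, $(\nu_0,\nu_1,\nu_2)=(0,0,1/\alpha)$, $\Theta=[0,\infty)$. - GHS (generalized hyperbolic secant): $\tau_iY_i\sim\mathrm{GHS}(\tau_i\alpha,\lambda_i)$,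 $\alpha>0$ a known constant, $\lambda_i\in\mathbb R$, where $\mathrm{GHS}(r,\lambda)$ is the law of $X$ with $E e^{sX}=\left(\frac{\cos\eta}{\cos(\eta+s)}\right)^r$ for $|\eta+s|<\pi/2$, $\eta=\arctan\lambda$ (mean $r\lambda$, variance $r(1+\lambda^2)$); $\theta_i=\alpha\lambda_i$, $(\nu_0,\nu_1,\nu_2)=(\alpha,0,1/\alpha)$, $\Theta=\mathbb R$. Loss and risk: $l_p(\boldsymbol\theta,\hat{\boldsymbol\theta})=\frac1p\sum_{i=1}^p(\hat\theta_i-\theta_i)^2$, $R_p=E[l_p]$. $\mathrm{URE}^P(\gamma,\mu)=\frac1p\sum_{i=1}^p\left[\frac{\gamma^2}{(\tau_i+\gamma)^2}(Y_i-\mu)^2+\frac{\tau_i-\gamma}{\tau_i+\gamma}\cdot\frac{V(Y_i)}{\tau_i+\nu_2}\right]$, with the value at $\gamma=\infty$ given by the limit $\gamma\to\infty$ (likewise $\frac{\tau_i}{\tau_i+\infty}=0$, $\frac{\infty}{\tau_i+\infty}=1$). Parametric URE shrinkage estimator: $\hat\theta_i^{\mathrm{PM}}=\frac{\tau_i}{\tau_i+\hat\gamma^{\mathrm{PM}}}Y_i+\frac{\hat\gamma^{\mathrm{PM}}}{\tau_i+\hat\gamma^{\mathrm{PM}}}\hat\mu^{\mathrm{PM}}$, where $(\hat\gamma^{\mathrm{PM}},\hat\mu^{\mathrm{PM}})$ is a (measurable) minimizer of $\mathrm{URE}^P(\gamma,\mu)$ over $0\le\gamma\le\infty$, $|\mu|\le\max_{1\le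 i\le p}|Y_i|$, $\mu\in\Theta$. All random quantities are measurable. *)

theory Defs
  imports "HOL-Probability.Probability" "HOL-Library.Landau_Symbols" "HOL-Real_Asymp.Real_Asymp"
begin

text \<open>
  The five non-Gaussian natural exponential families with quadratic variance function. A value of
  the type is one family together with all its parameter sequences (entries with index \<open>i \<ge> 1\<close>
  matter); the real argument of \<open>Gamma_fam\<close> and \<open>GHS_fam\<close> is the known constant \<open>\<alpha>\<close>.
\<close>

datatype nef_qvf =
    Binomial_fam (* n *) "nat \<Rightarrow> nat" (* p *) "nat \<Rightarrow> real"
  | Poisson_fam (* tau *) "nat \<Rightarrow> real" (* theta *) "nat \<Rightarrow> real"
  | NegBin_fam (* n *) "nat \<Rightarrow> nat" (* p *) "nat \<Rightarrow> real"
  | Gamma_fam (* alpha *) real (* tau *) "nat \<Rightarrow> real" (* lambda *) "nat \<Rightarrow> real"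
  | GHS_fam (* alpha *) real (* tau *) "nat \<Rightarrow> real" (* lambda *) "nat \<Rightarrow> real"

fun valid_params :: "nef_qvf \<Rightarrow> bool" where
  "valid_params (Binomial_fam n p) \<longleftrightarrow> (\<forall>i\<ge>1. n i \<ge> 1 \<and> 0 < p i \<and> p i < 1)"
| "valid_params (Poisson_fam t th) \<longleftrightarrow> (\<forall>i\<ge>1. t i > 0 \<and> th i > 0)"
| "valid_params (NegBin_fam n p) \<longleftrightarrow> (\<forall>i\<ge>1. n i \<ge> 1 \<and> 0 < p i \<and> p i < 1)"
| "valid_params (Gamma_fam \<alpha> t l) \<longleftrightarrow> \<alpha> > 0 \<and> (\<forall>i\<ge>1. t i > 0 \<and> l i > 0)"
| "valid_params (GHS_fam \<alpha> t l) \<longleftrightarrow> \<alpha> > 0 \<and> (\<forall>i\<ge>1. t i > 0)"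

fun tau :: "nef_qvf \<Rightarrow> nat \<Rightarrow> real" where
  "tau (Binomial_fam n p) i = real (n i)"
| "tau (Poisson_fam t th) i = t i"
| "tau (NegBin_fam n p) i = real (n i)"
| "tau (Gamma_fam \<alpha> t l) i = t i"
| "tau (GHS_fam \<alpha> t l) i = t i"

fun theta :: "nef_qvf \<Rightarrow> nat \<Rightarrow> real" where
  "theta (Binomial_fam n p) i = p i"
| "theta (Poisson_fam t th) i = th i"
| "theta (NegBin_fam n p) i = p i / (1 - p i)"
| "theta (Gamma_fam \<alpha> t l) i = \<alpha> * l i"
| "theta (GHS_fam \<alpha> t l) i = \<alpha> * l i"

fun nu0 :: "nef_qvf \<Rightarrow> real" where
  "nu0 (Binomial_fam n p) = 0"
| "nu0 (Poisson_fam t th) = 0"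
| "nu0 (NegBin_fam n p) = 0"
| "nu0 (Gamma_fam \<alpha> t l) = 0"
| "nu0 (GHS_fam \<alpha> t l) = \<alpha>"

fun nu1 :: "nef_qvf \<Rightarrow> real" where
  "nu1 (Binomial_fam n p) = 1"
| "nu1 (Poisson_fam t th) = 1"
| "nu1 (NegBin_fam n p) = 1"
| "nu1 (Gamma_fam \<alpha> t l) = 0"
| "nu1 (GHS_fam \<alpha> t l) = 0"

fun nu2 :: "nef_qvf \<Rightarrow> real" where
  "nu2 (Binomial_fam n p) = -1"
| "nu2 (Poisson_fam t th) = 0"
| "nu2 (NegBin_fam n p) = 1"
| "nu2 (Gamma_fam \<alpha> t l) = 1 / \<alpha>"
| "nu2 (GHS_fam \<alpha> t l) = 1 / \<alpha>"

fun mean_space :: "nef_qvf \<Rightarrow> real set" where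
  "mean_space (Binomial_fam n p) = {0..1}"
| "mean_space (Poisson_fam t th) = {0..}"
| "mean_space (NegBin_fam n p) = {0..}"
| "mean_space (Gamma_fam \<alpha> t l) = {0..}"
| "mean_space (GHS_fam \<alpha> t l) = UNIV"

definition Vfun :: "nef_qvf \<Rightarrow> real \<Rightarrow> real" where
  "Vfun F x = nu0 F + nu1 F * x + nu2 F * x\<^sup>2"

text \<open>Gamma density with shape \<open>k\<close> and scale \<open>l\<close>.\<close>

definition gamma_density :: "real \<Rightarrow> real \<Rightarrow> real \<Rightarrow> real" where
  "gamma_density k l x =
     (if x > 0 then x powr (k - 1) * exp (- x / l) / (Gamma k * l powr k) else 0)"

text \<open>
  \<open>X\<close> has the generalized hyperbolic secant law \<open>GHS(r, l)\<close>. The moment generating function is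
  prescribed on a neighbourhood of \<open>0\<close>, so it determines the law.
\<close>

definition has_GHS_law :: "'a measure \<Rightarrow> real \<Rightarrow> real \<Rightarrow> ('a \<Rightarrow> real) \<Rightarrow> bool" where
  "has_GHS_law M r l X \<longleftrightarrow> X \<in> borel_measurable M \<and>
     (\<forall>s. \<bar>arctan l + s\<bar> < pi / 2 \<longrightarrow>
        has_bochner_integral M (\<lambda>\<omega>. exp (s * X \<omega>)) ((cos (arctan l) / cos (arctan l + s)) powr r))"

text \<open>
  The law of the \<open>i\<close>-th observation \<open>Z\<close>, always stated through the rescaled variable
  \<open>tau F i * Z\<close>. The library's \<open>neg_binomial_pmf\<close> takes the probability that is raised to the
  power \<open>n\<close>, i.e. \<open>1 - p\<close> here.
\<close>

fun has_family_law :: "'a measure \<Rightarrow> nef_qvf \<Rightarrow> nat \<Rightarrow> ('a \<Rightarrow> real) \<Rightarrow> bool" where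
  "has_family_law M (Binomial_fam n p) i Z \<longleftrightarrow>
     Z \<in> borel_measurable M \<and>
     distr M borel (\<lambda>\<omega>. real (n i) * Z \<omega>) = distr (measure_pmf (binomial_pmf (n i) (p i))) borel real"
| "has_family_law M (Poisson_fam t th) i Z \<longleftrightarrow>
     Z \<in> borel_measurable M \<and>
     distr M borel (\<lambda>\<omega>. t i * Z \<omega>) = distr (measure_pmf (poisson_pmf (t i * th i))) borel real"
| "has_family_law M (NegBin_fam n p) i Z \<longleftrightarrow>
     Z \<in> borel_measurable M \<and>
     distr M borel (\<lambda>\<omega>. real (n i) * Z \<omega>) =
       distr (measure_pmf (neg_binomial_pmf (n i) (1 - p i))) borel real"
| "has_family_law M (Gamma_fam \<alpha> t l) i Z \<longleftrightarrow>
     distributed M lborel (\<lambda>\<omega>. t i * Z \<omega>) (\<lambda>x. ennreal (gamma_density (t i * \<alpha>) (l i) x))"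
| "has_family_law M (GHS_fam \<alpha> t l) i Z \<longleftrightarrow>
     has_GHS_law M (t i * \<alpha>) (l i) (\<lambda>\<omega>. t i * Z \<omega>)"

lemma pmf_NegBin:
  assumes "0 < p" "p < 1"
  shows "pmf (neg_binomial_pmf n (1 - p)) k = real ((n + k - 1) choose k) * p ^ k * (1 - p) ^ n"
  using assms by (subst pmf_neg_binomial) (auto simp: mult_ac add_ac)

fun family_condition :: "nef_qvf \<Rightarrow> bool" where
  "family_condition (Binomial_fam n p) \<longleftrightarrow> (\<forall>i\<ge>1. n i \<ge> 2)"
| "family_condition (Poisson_fam t th) \<longleftrightarrow>
     (INF i\<in>{1..}. t i) > 0 \<and> (INF i\<in>{1..}. t i * th i) > 0 \<and>
     (\<lambda>p. \<Sum>i=1..p. th i ^ 3) \<in> O(\<lambda>p. real p)"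
| "family_condition (NegBin_fam n p) \<longleftrightarrow>
     (INF i\<in>{1..}. real (n i) * p i) > 0 \<and>
     (\<lambda>m. \<Sum>i=1..m. (p i / (1 - p i)) ^ 4) \<in> O(\<lambda>m. real m)"
| "family_condition (Gamma_fam \<alpha> t l) \<longleftrightarrow>
     (INF i\<in>{1..}. t i) > 0 \<and> (\<lambda>p. \<Sum>i=1..p. l i ^ 4) \<in> O(\<lambda>p. real p)"
| "family_condition (GHS_fam \<alpha> t l) \<longleftrightarrow>
     (INF i\<in>{1..}. t i) > 0 \<and> (\<lambda>p. \<Sum>i=1..p. l i ^ 4) \<in> O(\<lambda>p. real p)"

text \<open>
  Below, \<open>p\<close> is the number of coordinates, the argument \<open>y\<close> is an observed vector with coordinates
  \<open>y 1, \<dots>, y p\<close>, and \<open>g :: ennreal\<close> is the shrinkage parameter, ranging over \<open>[0, \<infinity>]\<close>.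
\<close>

definition max_abs :: "nat \<Rightarrow> (nat \<Rightarrow> real) \<Rightarrow> real" where
  "max_abs p y = Max ((\<lambda>i. \<bar>y i\<bar>) ` {1..p})"

definition URE_fin :: "nef_qvf \<Rightarrow> nat \<Rightarrow> (nat \<Rightarrow> real) \<Rightarrow> real \<Rightarrow> real \<Rightarrow> real" where
  "URE_fin F p y g m = (1 / real p) *
     (\<Sum>i=1..p. g\<^sup>2 / (tau F i + g)\<^sup>2 * (y i - m)\<^sup>2
        + (tau F i - g) / (tau F i + g) * (Vfun F (y i) / (tau F i + nu2 F)))"

definition URE :: "nef_qvf \<Rightarrow> nat \<Rightarrow> (nat \<Rightarrow> real) \<Rightarrow> ennreal \<Rightarrow> real \<Rightarrow> real" where
  "URE F p y g m =
     (if g = \<infinity> then Lim at_top (\<lambda>x. URE_fin F p y x m) else URE_fin F p y (enn2real g) m)"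

lemma tendsto_URE_fin:
  "((\<lambda>x. URE_fin F p y x m) \<longlongrightarrow>
     (1 / real p) * (\<Sum>i=1..p. (y i - m)\<^sup>2 - Vfun F (y i) / (tau F i + nu2 F))) at_top"
proof -
  have 1: "((\<lambda>x. x\<^sup>2 / (c + x)\<^sup>2) \<longlongrightarrow> 1) at_top" for c :: real
    by real_asymp
  have 2: "((\<lambda>x. (c - x) / (c + x)) \<longlongrightarrow> -1) at_top" for c :: real
    by real_asymp
  have "((\<lambda>x. URE_fin F p y x m) \<longlongrightarrow>
     (1 / real p) * (\<Sum>i=1..p. 1 * (y i - m)\<^sup>2 + (-1) * (Vfun F (y i) / (tau F i + nu2 F)))) at_top"
    unfolding URE_fin_def by (intro tendsto_intros 1 2)
  then show ?thesis by simp
qed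

lemma URE_infinity:
  "URE F p y \<infinity> m =
     (1 / real p) * (\<Sum>i=1..p. (y i - m)\<^sup>2 - Vfun F (y i) / (tau F i + nu2 F))"
  unfolding URE_def using tendsto_Lim[OF _ tendsto_URE_fin] by simp

text \<open>
  \<open>(g, m)\<close> minimizes \<open>URE\<close> over \<open>0 \<le> g \<le> \<infinity>\<close>, \<open>\<bar>m\<bar> \<le> max\<^sub>i \<bar>y i\<bar>\<close>, \<open>m \<in> mean_space F\<close>.
\<close>

definition URE_minimizer :: "nef_qvf \<Rightarrow> nat \<Rightarrow> (nat \<Rightarrow> real) \<Rightarrow> ennreal \<Rightarrow> real \<Rightarrow> bool" where
  "URE_minimizer F p y g m \<longleftrightarrow>
     is_arg_min (\<lambda>(g, m). URE F p y g m) (\<lambda>(g, m). \<bar>m\<bar> \<le> max_abs p y \<and> m \<in> mean_space F) (g, m)"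

definition shrinkage :: "nef_qvf \<Rightarrow> (nat \<Rightarrow> real) \<Rightarrow> ennreal \<Rightarrow> real \<Rightarrow> nat \<Rightarrow> real" where
  "shrinkage F y g m i =
     (if g = \<infinity> then m
      else tau F i / (tau F i + enn2real g) * y i + enn2real g / (tau F i + enn2real g) * m)"

definition loss :: "nat \<Rightarrow> (nat \<Rightarrow> real) \<Rightarrow> (nat \<Rightarrow> real) \<Rightarrow> real" where
  "loss p th est = (1 / real p) * (\<Sum>i=1..p. (est i - th i)\<^sup>2)"

definition risk :: "'a measure \<Rightarrow> nat \<Rightarrow> (nat \<Rightarrow> real) \<Rightarrow> ('a \<Rightarrow> nat \<Rightarrow> real) \<Rightarrow> real" where
  "risk M p th est = (LINT \<omega>|M. loss p th (est \<omega>))"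

end

theory Submission
  imports Defs "HOL-Library.Discrete_Functions"
begin

text \<open>
  Write \<open>b\<^sub>i = \<gamma> / (\<tau>\<^sub>i + \<gamma>)\<close>, \<open>u\<^sub>i = Y\<^sub>i - \<theta>\<^sub>i\<close> and \<open>W\<^sub>i = V(Y\<^sub>i) / (\<tau>\<^sub>i + \<nu>\<^sub>2)\<close>. Expanding the
  squares gives, for every \<open>\<gamma>\<close> in \<open>[0, \<infinity>]\<close> and every \<open>\<mu>\<close>,

    \<open>p (URE - loss) = \<Sum> (W\<^sub>i - u\<^sub>i\<^sup>2) + 2 \<Sum> b\<^sub>i (u\<^sub>i\<^sup>2 + \<theta>\<^sub>i u\<^sub>i - W\<^sub>i) - 2 \<mu> \<Sum> b\<^sub>i u\<^sub>i\<close>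

  (\<open>URE_minus_loss\<close>). Because the variance function is quadratic, \<open>W\<^sub>i\<close> is an unbiased estimator of
  the variance of \<open>Y\<^sub>i\<close>, so each of the three sums is a weighted sum of independent centred variables.
  The gap has to be small uniformly in \<open>\<gamma>\<close> and in \<open>\<bar>\<mu>\<bar> \<le> max\<^sub>i \<bar>Y\<^sub>i\<bar>\<close>, since both parameters are chosen
  after seeing the data.

  Uniformity in \<open>\<gamma>\<close> rests on monotonicity: the weights \<open>b\<^sub>i\<close> lie in \<open>[0, 1]\<close> and decrease in \<open>\<tau>\<^sub>i\<close>, in an
  order of the indices that does not depend on \<open>\<gamma>\<close>. Summation by parts in that order bounds every such
  weighted sum by the largest partial sum, and the dyadic argument of Rademacher and Menshov bounds the
  second moment of the largest partial sum by \<open>n\<^sup>2\<close> times the sum of the variances as soon as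
  \<open>p < 2\<^sup>n\<close> (\<open>monotone_weights_maximal\<close>). This uses orthogonality only, and the logarithmic loss is
  harmless. Uniformity in \<open>\<mu>\<close> only needs that the second moment of \<open>max\<^sub>i \<bar>Y\<^sub>i\<bar>\<close> is of order \<open>p\<close> to the
  power \<open>2/3\<close>, which follows from bounded average third absolute moments. Together this yields a random
  variable that dominates the gap for all \<open>\<gamma>\<close> and \<open>\<mu>\<close> and whose expectation tends to \<open>0\<close>
  (\<open>uniform_gap\<close>).

  The moments come from one computation for all five families. In each of them the moment generating
  function \<open>\<phi>\<close> of \<open>\<tau>\<^sub>i Y\<^sub>i\<close> satisfies \<open>\<phi>' = \<tau>\<^sub>i \<mu> \<phi>\<close> near \<open>0\<close>, where \<open>\<mu>\<close> is the mean of the exponentially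
  tilted law and satisfies \<open>\<mu>' = V(\<mu>)\<close>. These two equations determine all central moments up to order
  four as polynomials in \<open>\<theta>\<^sub>i\<close>, \<open>V(\<theta>\<^sub>i)\<close> and \<open>1/\<tau>\<^sub>i\<close> (\<open>qvf_central_moments\<close>). The conditions on the
  parameters then bound the sums of variances of the three kinds of summands by a multiple of \<open>p\<close>
  (\<open>family_moment_envelope\<close>).

  Finally, the minimizer has a value of \<open>URE\<close> no larger than the competitor's, even when the competitor's
  \<open>\<mu>\<close> lies outside the mean space: the observations lie in the mean space almost surely, so projecting
  \<open>\<mu>\<close> onto it brings \<open>\<mu>\<close> closer to all of them, which cannot increase \<open>URE\<close> (\<open>URE_minimizer_le\<close>).
  Hence the minimizer loses at most twice the dominating variable against any competitor, and Markov's
  inequality and taking expectations give the two claims.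
\<close>

section \<open>Moments from the moment generating function\<close>

text \<open>
  The domination that lets the exponential series of \<open>exp (s * X)\<close> be integrated term by term.
\<close>

lemma exp_partial_sum_le:
  fixes y :: real
  shows "\<bar>\<Sum>k<n. y ^ k / fact k\<bar> \<le> exp \<bar>y\<bar>"
proof -
  have "\<bar>\<Sum>k<n. y ^ k / fact k\<bar> \<le> (\<Sum>k<n. \<bar>y\<bar> ^ k / fact k)"
    by (rule order_trans[OF sum_abs]) (simp add: power_abs)
  also have "\<dots> \<le> (\<Sum>k. \<bar>y\<bar> ^ k / fact k)"
    by (rule sum_le_suminf) (use summable_exp_generic[of "\<bar>y\<bar>"] in \<open>auto simp: divide_inverse_commute\<close>)
  also have "\<dots> = exp \<bar>y\<bar>"
    by (simp add: exp_def divide_inverse_commute)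
  finally show ?thesis .
qed

lemma power_le_fact_exp:
  fixes y :: real
  shows "\<bar>y\<bar> ^ k \<le> fact k * exp \<bar>y\<bar>"
proof -
  have "\<bar>y\<bar> ^ k / fact k \<le> (\<Sum>j<Suc k. \<bar>y\<bar> ^ j / fact j)"
    by (simp add: sum_nonneg)
  also have "\<dots> \<le> exp \<bar>y\<bar>"
    using exp_partial_sum_le[of "\<bar>y\<bar>" "Suc k"] by (simp del: sum.lessThan_Suc)
  finally show ?thesis by (simp add: field_simps)
qed

lemma exp_abs_le:
  fixes y :: real
  shows "exp \<bar>y\<bar> \<le> exp y + exp (- y)"
  by (cases "y \<ge> 0") auto

context prob_space
begin

lemma integrable_power_of_mgf:
  fixes X :: "'a \<Rightarrow> real"
  assumes [measurable]: "X \<in> borel_measurable M"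
    and "s \<noteq> 0" "integrable M (\<lambda>\<omega>. exp (s * X \<omega>))" "integrable M (\<lambda>\<omega>. exp (- s * X \<omega>))"
  shows "integrable M (\<lambda>\<omega>. X \<omega> ^ k)"
proof (rule Bochner_Integration.integrable_bound)
  show "integrable M (\<lambda>\<omega>. fact k / \<bar>s\<bar> ^ k * (exp (s * X \<omega>) + exp (- s * X \<omega>)))"
    using assms by auto
  show "AE \<omega> in M. norm (X \<omega> ^ k)
      \<le> norm (fact k / \<bar>s\<bar> ^ k * (exp (s * X \<omega>) + exp (- s * X \<omega>)))"
  proof (rule AE_I2)
    fix \<omega>
    have "\<bar>s * X \<omega>\<bar> ^ k \<le> fact k * exp \<bar>s * X \<omega>\<bar>"
      by (rule power_le_fact_exp)
    also have "\<dots> \<le> fact k * (exp (s * X \<omega>) + exp (- s * X \<omega>))"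
      using exp_abs_le[of "s * X \<omega>"] by simp
    finally show "norm (X \<omega> ^ k)
      \<le> norm (fact k / \<bar>s\<bar> ^ k * (exp (s * X \<omega>) + exp (- s * X \<omega>)))"
      using \<open>s \<noteq> 0\<close> by (simp add: abs_mult power_mult_distrib power_abs field_simps)
  qed
qed measurable

text \<open>
  The moment generating function is a power series in \<open>s\<close> whose coefficients are the moments: dominated
  convergence applied to the partial sums of the exponential series, which are bounded by
  \<open>exp (s X) + exp (- s X)\<close>.
\<close>

lemma mgf_sums_moments:
  fixes X :: "'a \<Rightarrow> real"
  assumes [measurable]: "X \<in> borel_measurable M"
    and "s \<noteq> 0" "integrable M (\<lambda>\<omega>. exp (s * X \<omega>))" "integrable M (\<lambda>\<omega>. exp (- s * X \<omega>))"
  shows "(\<lambda>k. expectation (\<lambda>\<omega>. X \<omega> ^ k) / fact k * s ^ k) sums expectation (\<lambda>\<omega>. exp (s * X \<omega>))"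
proof -
  have "(\<lambda>n. expectation (\<lambda>\<omega>. \<Sum>k<n. (s * X \<omega>) ^ k / fact k))
      \<longlonglongrightarrow> expectation (\<lambda>\<omega>. exp (s * X \<omega>))"
  proof (rule integral_dominated_convergence[where w = "\<lambda>\<omega>. exp (s * X \<omega>) + exp (- s * X \<omega>)"])
    show "integrable M (\<lambda>\<omega>. exp (s * X \<omega>) + exp (- s * X \<omega>))"
      using assms by auto
    show "AE \<omega> in M. (\<lambda>n. \<Sum>k<n. (s * X \<omega>) ^ k / fact k) \<longlonglongrightarrow> exp (s * X \<omega>)"
      using exp_converges[where ?'a = real] by (simp add: sums_def divide_inverse_commute scaleR_conv_of_real)
    show "AE \<omega> in M. norm (\<Sum>k<n. (s * X \<omega>) ^ k / fact k) \<le> exp (s * X \<omega>) + exp (- s * X \<omega>)" for n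
    proof (rule AE_I2)
      fix \<omega>
      show "norm (\<Sum>k<n. (s * X \<omega>) ^ k / fact k) \<le> exp (s * X \<omega>) + exp (- s * X \<omega>)"
        using exp_partial_sum_le[of "s * X \<omega>" n] exp_abs_le[of "s * X \<omega>"] by simp
    qed
  qed measurable
  moreover have "expectation (\<lambda>\<omega>. \<Sum>k<n. (s * X \<omega>) ^ k / fact k)
      = (\<Sum>k<n. expectation (\<lambda>\<omega>. X \<omega> ^ k) / fact k * s ^ k)" for n
    using integrable_power_of_mgf[OF assms]
    by (simp add: power_mult_distrib Bochner_Integration.integral_sum ac_simps)
  ultimately show ?thesis
    by (simp add: sums_def)
qed

end

text \<open>
  Taylor coefficients are determined by the sum of the series near \<open>0\<close>. The derivatives are given as a
  finite chain \<open>\<Phi> 0, \<Phi> 1, \<dots>\<close> of explicit functions, so that no iterated derivative has to be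
  computed; each step of the induction differentiates the series once.
\<close>

lemma powser_coeff_eq_deriv:
  fixes c :: "nat \<Rightarrow> real" and \<Phi> :: "nat \<Rightarrow> real \<Rightarrow> real"
  assumes "\<delta> > 0"
    and "\<And>s. \<bar>s\<bar> < \<delta> \<Longrightarrow> (\<lambda>k. c k * s ^ k) sums \<Phi> 0 s"
    and "\<And>k s. k < n \<Longrightarrow> \<bar>s\<bar> < \<delta> \<Longrightarrow> (\<Phi> k has_real_derivative \<Phi> (Suc k) s) (at s)"
    and "k \<le> n"
  shows "c k = \<Phi> k 0 / fact k"
  using assms(2-4)
proof (induction n arbitrary: k c \<Phi>)
  case 0
  have "(\<lambda>k. c k * 0 ^ k) sums \<Phi> 0 0" by (rule 0) (use \<open>\<delta> > 0\<close> in simp)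
  then show ?case using powser_sums_zero_iff[of c "\<Phi> 0 0"] \<open>k \<le> 0\<close> by simp
next
  case (Suc n)
  show ?case
  proof (cases k)
    case 0
    have "(\<lambda>k. c k * 0 ^ k) sums \<Phi> 0 0" by (rule Suc.prems(1)) (use \<open>\<delta> > 0\<close> in simp)
    then show ?thesis using powser_sums_zero_iff[of c "\<Phi> 0 0"] 0 by simp
  next
    case (Suc j)
    have sums': "(\<lambda>k. diffs c k * s ^ k) sums \<Phi> 1 s" if s: "\<bar>s\<bar> < \<delta>" for s
    proof -
      obtain r where r: "\<bar>s\<bar> < r" "r < \<delta>" using dense[OF s] by blast
      have summ: "summable (\<lambda>k. c k * r ^ k)"
        by (rule sums_summable[OF Suc.prems(1)]) (use r in linarith)
      have "((\<lambda>x. \<Sum>k. c k * x ^ k) has_real_derivative (\<Sum>k. diffs c k * s ^ k)) (at s)"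
        by (rule termdiffs_strong[OF summ]) (use r in auto)
      moreover have "eventually (\<lambda>x. (\<Sum>k. c k * x ^ k) = \<Phi> 0 x) (nhds s)"
      proof -
        have "eventually (\<lambda>x. x \<in> {-\<delta><..<\<delta>}) (nhds s)"
          by (rule eventually_nhds_in_open) (use s in auto)
        then show ?thesis
        proof (rule eventually_mono)
          fix x assume "x \<in> {-\<delta><..<\<delta>}"
          then have "\<bar>x\<bar> < \<delta>" by auto
          then show "(\<Sum>k. c k * x ^ k) = \<Phi> 0 x" by (rule sums_unique[OF Suc.prems(1), symmetric])
        qed
      qed
      ultimately have "(\<Phi> 0 has_real_derivative (\<Sum>k. diffs c k * s ^ k)) (at s)"
        using DERIV_cong_ev[OF refl _ refl, of "\<lambda>x. \<Sum>k. c k * x ^ k" "\<Phi> 0" s] by simp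
      then have "(\<Sum>k. diffs c k * s ^ k) = \<Phi> 1 s"
        by (rule DERIV_unique) (use Suc.prems(2)[of 0 s] s in simp)
      moreover have "summable (\<lambda>k. diffs c k * s ^ k)"
      proof (rule termdiff_converges[of s r])
        fix x :: real assume "norm x < r"
        then have "\<bar>x\<bar> < \<delta>" using r by simp
        then show "summable (\<lambda>k. c k * x ^ k)" by (rule sums_summable[OF Suc.prems(1)])
      qed (use r in simp)
      ultimately show ?thesis by (metis summable_sums)
    qed
    have "diffs c j = \<Phi> (Suc j) 0 / fact j"
    proof (rule Suc.IH[where \<Phi> = "\<lambda>k. \<Phi> (Suc k)"])
      show "(\<lambda>k. diffs c k * s ^ k) sums \<Phi> (Suc 0) s" if "\<bar>s\<bar> < \<delta>" for s
        using sums'[OF that] by simp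
      show "(\<Phi> (Suc k) has_real_derivative \<Phi> (Suc (Suc k)) s) (at s)"
        if "k < n" "\<bar>s\<bar> < \<delta>" for k s
        by (rule Suc.prems(2)) (use that in auto)
      show "j \<le> n" using Suc.prems(3) \<open>k = Suc j\<close> by simp
    qed
    then show ?thesis
      using \<open>k = Suc j\<close> by (simp add: diffs_def eq_divide_eq ac_simps del: of_nat_Suc)
  qed
qed

lemma (in prob_space) moment_eq_mgf_deriv:
  fixes X :: "'a \<Rightarrow> real" and \<Phi> :: "nat \<Rightarrow> real \<Rightarrow> real"
  assumes [measurable]: "X \<in> borel_measurable M"
    and \<delta>: "\<delta> > 0"
    and mgf: "\<And>s. \<bar>s\<bar> < \<delta> \<Longrightarrow> has_bochner_integral M (\<lambda>\<omega>. exp (s * X \<omega>)) (\<Phi> 0 s)"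
    and deriv: "\<And>k s. k < n \<Longrightarrow> \<bar>s\<bar> < \<delta> \<Longrightarrow> (\<Phi> k has_real_derivative \<Phi> (Suc k) s) (at s)"
    and "k \<le> n"
  shows "has_bochner_integral M (\<lambda>\<omega>. X \<omega> ^ k) (\<Phi> k 0)"
proof -
  have int: "integrable M (\<lambda>\<omega>. exp (s * X \<omega>))" if "\<bar>s\<bar> < \<delta>" for s
    using mgf[OF that] by (simp add: has_bochner_integral_iff)
  have "expectation (\<lambda>\<omega>. X \<omega> ^ k) / fact k = \<Phi> k 0 / fact k"
  proof (rule powser_coeff_eq_deriv[where c = "\<lambda>k. expectation (\<lambda>\<omega>. X \<omega> ^ k) / fact k" and \<Phi> = \<Phi>
        and n = n, OF \<delta> _ _ \<open>k \<le> n\<close>])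
    fix s :: real assume s: "\<bar>s\<bar> < \<delta>"
    have eq: "expectation (\<lambda>\<omega>. exp (s * X \<omega>)) = \<Phi> 0 s"
      using mgf[OF s] by (rule has_bochner_integral_integral_eq)
    show "(\<lambda>k. expectation (\<lambda>\<omega>. X \<omega> ^ k) / fact k * s ^ k) sums \<Phi> 0 s"
    proof (cases "s = 0")
      case True
      then show ?thesis using eq prob_space
        powser_sums_zero_iff[of "\<lambda>k. expectation (\<lambda>\<omega>. X \<omega> ^ k) / fact k" "\<Phi> 0 0"] by simp
    next
      case False
      then show ?thesis
        using mgf_sums_moments[of X s] int[OF s] int[of "- s"] s eq by simp
    qed
  qed (use deriv in auto)
  moreover have "integrable M (\<lambda>\<omega>. X \<omega> ^ k)"
    using integrable_power_of_mgf[of X "\<delta> / 2" k] int[of "\<delta> / 2"] int[of "- \<delta> / 2"] \<delta> by simp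
  ultimately show ?thesis
    by (simp add: has_bochner_integral_iff)
qed

lemma has_real_derivative_eq_rhs:
  "(f has_real_derivative D) (at s) \<Longrightarrow> (\<And>x. g x = f x) \<Longrightarrow> D = E \<Longrightarrow> (g has_real_derivative E) (at s)"
proof -
  assume "(f has_real_derivative D) (at s)" "\<And>x. g x = f x" "D = E"
  moreover from this(2) have "g = f" by (rule ext)
  ultimately show ?thesis by simp
qed

text \<open>
  Here \<open>\<mu> s\<close> is the mean of the law of \<open>Y\<close> tilted by \<open>exp (s t Y)\<close>. Since \<open>\<mu>' = V(\<mu>)\<close> with \<open>V\<close> quadratic,
  all derivatives of \<open>\<mu>\<close>, hence all cumulants, are polynomials in \<open>\<mu>\<close>; this is how the quadratic variance
  function determines the higher moments.
\<close>

lemma (in prob_space) qvf_central_moments: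
  fixes Y :: "'a \<Rightarrow> real" and \<phi> \<mu> :: "real \<Rightarrow> real" and a b c t :: real
  defines "V \<equiv> \<lambda>x. a + b * x + c * x\<^sup>2"
  defines "\<theta> \<equiv> \<mu> 0"
  assumes [measurable]: "Y \<in> borel_measurable M"
    and t: "t > 0" and \<delta>: "\<delta> > 0"
    and mgf: "\<And>s. \<bar>s\<bar> < \<delta> \<Longrightarrow> has_bochner_integral M (\<lambda>\<omega>. exp (s * (t * Y \<omega>))) (\<phi> s)"
    and \<phi>: "\<And>s. \<bar>s\<bar> < \<delta> \<Longrightarrow> (\<phi> has_real_derivative t * \<mu> s * \<phi> s) (at s)"
    and \<mu>: "\<And>s. \<bar>s\<bar> < \<delta> \<Longrightarrow> (\<mu> has_real_derivative V (\<mu> s)) (at s)"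
  shows "has_bochner_integral M (\<lambda>\<omega>. Y \<omega> - \<theta>) 0"
    and "has_bochner_integral M (\<lambda>\<omega>. (Y \<omega> - \<theta>)\<^sup>2) (V \<theta> / t)"
    and "has_bochner_integral M (\<lambda>\<omega>. (Y \<omega> - \<theta>) ^ 4)
           (3 * (V \<theta>)\<^sup>2 / t\<^sup>2 + ((b + 2 * c * \<theta>)\<^sup>2 * V \<theta> + 2 * c * (V \<theta>)\<^sup>2) / t ^ 3)"
proof -
  \<comment> \<open>\<open>\<psi>\<close> is the moment generating function of \<open>t * (Y - \<theta>)\<close>, \<open>d\<close> its logarithmic derivative, and
    \<open>d1\<close>, \<open>d2\<close>, \<open>d3\<close> are the derivatives of \<open>d\<close>: at \<open>0\<close> they are the second, third and fourth cumulants.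
    \<open>\<Phi> k\<close> is the \<open>k\<close>-th derivative of \<open>\<psi>\<close>.\<close>
  define d where "d = (\<lambda>s. t * (\<mu> s - \<theta>))"
  define d1 where "d1 = (\<lambda>s. t * V (\<mu> s))"
  define d2 where "d2 = (\<lambda>s. t * ((b + 2 * c * \<mu> s) * V (\<mu> s)))"
  define d3 where "d3 = (\<lambda>s. t * (2 * c * (V (\<mu> s))\<^sup>2 + (b + 2 * c * \<mu> s)\<^sup>2 * V (\<mu> s)))"
  define \<psi> where "\<psi> = (\<lambda>s. exp (- s * (t * \<theta>)) * \<phi> s)"
  define \<Phi> where "\<Phi> = (\<lambda>k s. [1, d s, d1 s + d s ^ 2, d2 s + 3 * d s * d1 s + d s ^ 3,
      d3 s + 4 * d s * d2 s + 3 * d1 s ^ 2 + 6 * d s ^ 2 * d1 s + d s ^ 4] ! k * \<psi> s)"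
  have \<psi>: "(\<psi> has_real_derivative d s * \<psi> s) (at s)" if "\<bar>s\<bar> < \<delta>" for s
    unfolding \<psi>_def d_def
    by (rule derivative_eq_intros refl \<phi> that)+ (simp add: algebra_simps)
  have d: "(d has_real_derivative d1 s) (at s)" if "\<bar>s\<bar> < \<delta>" for s
    unfolding d_def d1_def
    by (rule derivative_eq_intros refl \<mu> that)+ (simp add: algebra_simps)
  have d1: "(d1 has_real_derivative d2 s) (at s)" if "\<bar>s\<bar> < \<delta>" for s
    unfolding d1_def d2_def V_def
    by (rule derivative_eq_intros refl \<mu>[unfolded V_def] that)+ (simp add: algebra_simps power2_eq_square)
  have d2: "(d2 has_real_derivative d3 s) (at s)" if "\<bar>s\<bar> < \<delta>" for s
    unfolding d2_def d3_def V_def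
    by (rule derivative_eq_intros refl \<mu>[unfolded V_def] that)+ (simp add: algebra_simps power2_eq_square)
  have prod: "((\<lambda>s. P s * \<psi> s) has_real_derivative (P' + P s * d s) * \<psi> s) (at s)"
    if "(P has_real_derivative P') (at s)" "\<bar>s\<bar> < \<delta>" for P P' s
    by (rule DERIV_cong[OF DERIV_mult[OF that(1) \<psi>[OF that(2)]]]) (simp add: algebra_simps)
  have \<Phi>: "(\<Phi> k has_real_derivative \<Phi> (Suc k) s) (at s)" if "k < 4" "\<bar>s\<bar> < \<delta>" for k s
  proof -
    note der = d[OF that(2)] d1[OF that(2)] d2[OF that(2)]
    have P1: "((\<lambda>s. 1) has_real_derivative 0) (at s)" by simp
    have P3: "((\<lambda>s. d1 s + d s ^ 2) has_real_derivative d2 s + 2 * d s * d1 s) (at s)"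
      by (rule derivative_eq_intros der refl | simp)+
    have P4: "((\<lambda>s. d2 s + 3 * d s * d1 s + d s ^ 3) has_real_derivative
        d3 s + (3 * d1 s * d1 s + 3 * d s * d2 s) + 3 * d s ^ 2 * d1 s) (at s)"
      by (rule derivative_eq_intros der refl | simp)+
    consider "k = 0" | "k = 1" | "k = 2" | "k = 3" using \<open>k < 4\<close> by linarith
    then show ?thesis
    proof cases
      case 1
      show ?thesis unfolding 1 \<Phi>_def by (rule has_real_derivative_eq_rhs[OF prod[OF P1 that(2)]]) simp_all
    next
      case 2
      show ?thesis unfolding 2 \<Phi>_def
        by (rule has_real_derivative_eq_rhs[OF prod[OF der(1) that(2)]])
          (simp_all add: power2_eq_square)
    next
      case 3
      show ?thesis unfolding 3 \<Phi>_def
        by (rule has_real_derivative_eq_rhs[OF prod[OF P3 that(2)]])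
          (simp_all add: eval_nat_numeral algebra_simps)
    next
      case 4
      show ?thesis unfolding 4 \<Phi>_def
        by (rule has_real_derivative_eq_rhs[OF prod[OF P4 that(2)]])
          (simp_all add: eval_nat_numeral algebra_simps)
    qed
  qed
  have mom: "has_bochner_integral M (\<lambda>\<omega>. (t * (Y \<omega> - \<theta>)) ^ k) (\<Phi> k 0)" if "k \<le> 4" for k
  proof (rule moment_eq_mgf_deriv[where n = 4 and \<Phi> = \<Phi>, OF _ \<delta> _ _ that])
    fix s :: real assume s: "\<bar>s\<bar> < \<delta>"
    have "has_bochner_integral M (\<lambda>\<omega>. exp (- s * (t * \<theta>)) * exp (s * (t * Y \<omega>))) (\<psi> s)"
      unfolding \<psi>_def by (rule has_bochner_integral_mult_right) (use mgf[OF s] in simp)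
    also have "(\<lambda>\<omega>. exp (- s * (t * \<theta>)) * exp (s * (t * Y \<omega>))) = (\<lambda>\<omega>. exp (s * (t * (Y \<omega> - \<theta>))))"
      by (simp add: algebra_simps flip: exp_add)
    also have "\<psi> s = \<Phi> 0 s" by (simp add: \<Phi>_def)
    finally show "has_bochner_integral M (\<lambda>\<omega>. exp (s * (t * (Y \<omega> - \<theta>)))) (\<Phi> 0 s)" .
  qed (use \<Phi> in auto)
  have \<psi>0: "\<psi> 0 = 1"
    using mgf[of 0] \<delta> prob_space by (simp add: \<psi>_def has_bochner_integral_iff)
  have d0: "d 0 = 0" by (simp add: d_def \<theta>_def)
  have scaled: "has_bochner_integral M (\<lambda>\<omega>. (Y \<omega> - \<theta>) ^ k) (\<Phi> k 0 / t ^ k)" if "k \<le> 4" for k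
    using has_bochner_integral_divide_zero[OF mom[OF that], of "t ^ k"] t
    by (simp add: power_mult_distrib)
  show "has_bochner_integral M (\<lambda>\<omega>. Y \<omega> - \<theta>) 0"
    using scaled[of 1] by (simp add: \<Phi>_def d0)
  have "\<Phi> 2 0 / t ^ 2 = V \<theta> / t"
    using t by (simp add: \<Phi>_def d0 \<psi>0 d1_def eval_nat_numeral \<theta>_def)
  with scaled[of 2] show "has_bochner_integral M (\<lambda>\<omega>. (Y \<omega> - \<theta>)\<^sup>2) (V \<theta> / t)" by simp
  define U where "U = V \<theta>"
  define X where "X = (b + 2 * c * \<theta>)\<^sup>2 * V \<theta> + 2 * c * (V \<theta>)\<^sup>2"
  have "\<Phi> 4 0 = t * X + 3 * (t * U)\<^sup>2"
    by (simp add: \<Phi>_def d0 \<psi>0 d1_def d3_def \<theta>_def[symmetric] X_def U_def eval_nat_numeral)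
  also have "\<dots> / t ^ 4 = 3 * U\<^sup>2 / t\<^sup>2 + X / t ^ 3"
    using t by (simp add: field_simps eval_nat_numeral)
  finally have "\<Phi> 4 0 / t ^ 4 = 3 * (V \<theta>)\<^sup>2 / t\<^sup>2 + ((b + 2 * c * \<theta>)\<^sup>2 * V \<theta> + 2 * c * (V \<theta>)\<^sup>2) / t ^ 3"
    by (simp add: U_def X_def)
  with scaled[of 4] show "has_bochner_integral M (\<lambda>\<omega>. (Y \<omega> - \<theta>) ^ 4)
           (3 * (V \<theta>)\<^sup>2 / t\<^sup>2 + ((b + 2 * c * \<theta>)\<^sup>2 * V \<theta> + 2 * c * (V \<theta>)\<^sup>2) / t ^ 3)" by simp
qed

section \<open>Moment generating functions of the five families\<close>

text \<open>
  The common shape of the five families: \<open>\<mu>\<close> is the mean of the exponentially tilted law, and its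
  evolution under tilting is governed by the variance function.
\<close>

definition has_qvf_mgf :: "'a measure \<Rightarrow> nef_qvf \<Rightarrow> nat \<Rightarrow> ('a \<Rightarrow> real) \<Rightarrow> bool" where
  "has_qvf_mgf M F i Z \<longleftrightarrow> Z \<in> borel_measurable M \<and>
     (\<exists>\<delta>>0. \<exists>\<phi> \<mu>. \<mu> 0 = theta F i \<and>
       (\<forall>s. \<bar>s\<bar> < \<delta> \<longrightarrow>
          has_bochner_integral M (\<lambda>\<omega>. exp (s * (tau F i * Z \<omega>))) (\<phi> s) \<and>
          (\<phi> has_real_derivative tau F i * \<mu> s * \<phi> s) (at s) \<and>
          (\<mu> has_real_derivative Vfun F (\<mu> s)) (at s)))"

text \<open>
  Exponential tilting: if tilting \<open>q\<close> by \<open>exp (s k)\<close> gives a multiple of a probability mass function, the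
  multiple is the value of the moment generating function. For the three discrete families the tilted law
  is again a member of the family, so no series has to be summed.
\<close>

lemma has_bochner_integral_exp_pmf_tilt:
  fixes q q' :: "nat pmf"
  assumes "\<And>k. pmf q k * exp (s * real k) = c * pmf q' k"
  shows "has_bochner_integral (measure_pmf q) (\<lambda>k. exp (s * real k)) c"
proof -
  have c: "c \<ge> 0"
  proof (rule ccontr)
    assume "\<not> c \<ge> 0"
    obtain k where "k \<in> set_pmf q'" using set_pmf_not_empty[of q'] by auto
    then have "c * pmf q' k < 0" using \<open>\<not> c \<ge> 0\<close> by (simp add: pmf_positive mult_neg_pos)
    moreover have "pmf q k * exp (s * real k) \<ge> 0" by simp
    ultimately show False using assms[of k] by linarith
  qed
  have "(\<integral>\<^sup>+k. ennreal (exp (s * real k)) \<partial>measure_pmf q)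
      = (\<integral>\<^sup>+k. ennreal c * ennreal (pmf q' k) \<partial>count_space UNIV)"
    unfolding nn_integral_measure_pmf using c
    by (intro nn_integral_cong) (simp add: assms flip: ennreal_mult)
  also have "\<dots> = ennreal c"
    by (subst nn_integral_cmult) (auto simp: nn_integral_pmf measure_pmf.emeasure_space_1[simplified])
  finally show ?thesis
    using c by (intro has_bochner_integral_nn_integral) auto
qed

lemma has_bochner_integral_of_distr_eq:
  fixes f :: "real \<Rightarrow> real" and q :: "nat pmf"
  assumes [measurable]: "X \<in> borel_measurable M" "f \<in> borel_measurable borel"
    and "distr M borel X = distr (measure_pmf q) borel real"
    and "has_bochner_integral (measure_pmf q) (\<lambda>k. f (real k)) c"
  shows "has_bochner_integral M (\<lambda>\<omega>. f (X \<omega>)) c"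
proof -
  have "has_bochner_integral (distr (measure_pmf q) borel real) f c"
    using assms(4) by (subst has_bochner_integral_iff) (auto simp: has_bochner_integral_iff integrable_distr_eq integral_distr)
  then have "has_bochner_integral (distr M borel X) f c"
    by (simp only: assms(3))
  then show ?thesis
    by (auto simp: has_bochner_integral_iff integrable_distr_eq integral_distr)
qed

lemma AE_of_distr_eq:
  fixes P :: "real \<Rightarrow> bool" and q :: "nat pmf"
  assumes [measurable]: "X \<in> borel_measurable M" "Measurable.pred borel P"
    and "distr M borel X = distr (measure_pmf q) borel real"
    and "\<And>k. k \<in> set_pmf q \<Longrightarrow> P (real k)"
  shows "AE \<omega> in M. P (X \<omega>)"
proof -
  have "AE x in distr (measure_pmf q) borel real. P x"
    by (subst AE_distr_iff) (auto simp: AE_measure_pmf_iff assms(4))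
  then have "AE x in distr M borel X. P x" by (simp only: assms(3))
  then show ?thesis by (subst (asm) AE_distr_iff) auto
qed

lemma has_qvf_mgf_Poisson:
  assumes "valid_params (Poisson_fam t th)" "has_family_law M (Poisson_fam t th) i Z" "i \<ge> 1"
  shows "has_qvf_mgf M (Poisson_fam t th) i Z" and "AE \<omega> in M. Z \<omega> \<in> mean_space (Poisson_fam t th)"
proof -
  have pos: "t i > 0" "th i > 0" using assms by auto
  have [measurable]: "Z \<in> borel_measurable M" and
    law: "distr M borel (\<lambda>\<omega>. t i * Z \<omega>) = distr (measure_pmf (poisson_pmf (t i * th i))) borel real"
    using assms by auto
  define \<phi> where "\<phi> = (\<lambda>s. exp (t i * th i * (exp s - 1)))"
  have "has_bochner_integral M (\<lambda>\<omega>. exp (s * (t i * Z \<omega>))) (\<phi> s)" for s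
  proof (rule has_bochner_integral_of_distr_eq[OF _ _ law])
    show "has_bochner_integral (poisson_pmf (t i * th i)) (\<lambda>k. exp (s * real k)) (\<phi> s)"
      by (rule has_bochner_integral_exp_pmf_tilt[where q' = "poisson_pmf (t i * th i * exp s)"])
        (use pos in \<open>simp add: \<phi>_def power_mult_distrib algebra_simps exp_diff exp_minus field_simps flip: exp_of_nat_mult\<close>)
  qed measurable
  moreover have "(\<phi> has_real_derivative t i * (th i * exp s) * \<phi> s) (at s)" for s
    unfolding \<phi>_def by (auto intro!: derivative_eq_intros)
  moreover have "((\<lambda>s. th i * exp s) has_real_derivative Vfun (Poisson_fam t th) (th i * exp s)) (at s)" for s
    by (auto intro!: derivative_eq_intros simp: Vfun_def)
  ultimately show "has_qvf_mgf M (Poisson_fam t th) i Z"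
    unfolding has_qvf_mgf_def
    by (intro conjI exI[of _ "1::real"] exI[of _ \<phi>] exI[of _ "\<lambda>s. th i * exp s"]) auto
  have "AE \<omega> in M. t i * Z \<omega> \<ge> 0"
    by (rule AE_of_distr_eq[OF _ _ law]) auto
  then show "AE \<omega> in M. Z \<omega> \<in> mean_space (Poisson_fam t th)"
    using pos by (auto elim!: eventually_mono simp: zero_le_mult_iff)
qed

lemma has_qvf_mgf_Binomial:
  assumes "valid_params (Binomial_fam n p)" "has_family_law M (Binomial_fam n p) i Z" "i \<ge> 1"
  shows "has_qvf_mgf M (Binomial_fam n p) i Z" and "AE \<omega> in M. Z \<omega> \<in> mean_space (Binomial_fam n p)"
proof -
  have n: "n i \<ge> 1" and p: "0 < p i" "p i < 1" using assms by auto
  have [measurable]: "Z \<in> borel_measurable M" and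
    law: "distr M borel (\<lambda>\<omega>. n i * Z \<omega>) = distr (measure_pmf (binomial_pmf (n i) (p i))) borel real"
    using assms by auto
  define w where "w = (\<lambda>s. 1 - p i + p i * exp s)"
  have w: "w s > 0" for s using p by (auto simp: w_def intro!: add_pos_pos)
  define \<mu> where "\<mu> = (\<lambda>s. p i * exp s / w s)"
  have \<mu>: "0 < \<mu> s" "\<mu> s < 1" "1 - \<mu> s = (1 - p i) / w s" for s
    using p w[of s] by (auto simp: \<mu>_def field_simps w_def)
  have "has_bochner_integral M (\<lambda>\<omega>. exp (s * (n i * Z \<omega>))) (w s ^ n i)" for s
  proof (rule has_bochner_integral_of_distr_eq[OF _ _ law])
    show "has_bochner_integral (binomial_pmf (n i) (p i)) (\<lambda>k. exp (s * real k)) (w s ^ n i)"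
    proof (rule has_bochner_integral_exp_pmf_tilt[where q' = "binomial_pmf (n i) (\<mu> s)"])
      fix k
      show "pmf (binomial_pmf (n i) (p i)) k * exp (s * real k)
          = w s ^ n i * pmf (binomial_pmf (n i) (\<mu> s)) k"
      proof (cases "k \<le> n i")
        case True
        have "w s ^ n i * (\<mu> s ^ k * (1 - \<mu> s) ^ (n i - k))
            = (w s * \<mu> s) ^ k * (w s * (1 - \<mu> s)) ^ (n i - k)"
          using True by (simp add: power_mult_distrib flip: power_add)
        also have "w s * \<mu> s = p i * exp s" using w[of s] by (simp add: \<mu>_def)
        also have "w s * (1 - \<mu> s) = 1 - p i" using w[of s] by (simp add: \<mu>)
        finally show ?thesis
          using p \<mu>[of s] by (simp add: power_mult_distrib mult_ac flip: exp_of_nat_mult)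
      qed (use p \<mu>[of s] in simp)
    qed
  qed measurable
  moreover have "((\<lambda>s. w s ^ n i) has_real_derivative n i * \<mu> s * w s ^ n i) (at s)" for s
  proof -
    have "((\<lambda>s. w s ^ n i) has_real_derivative n i * w s ^ (n i - 1) * (p i * exp s)) (at s)"
      unfolding w_def by (auto intro!: derivative_eq_intros)
    also have "n i * w s ^ (n i - 1) * (p i * exp s) = n i * \<mu> s * w s ^ n i"
      using w[of s] n by (cases "n i") (auto simp: \<mu>_def)
    finally show ?thesis .
  qed
  moreover have "(\<mu> has_real_derivative Vfun (Binomial_fam n p) (\<mu> s)) (at s)" for s
  proof -
    have w': "(w has_real_derivative p i * exp s) (at s)"
      unfolding w_def by (auto intro!: derivative_eq_intros)
    show ?thesis
      unfolding \<mu>_def using w[of s]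
      by (auto intro!: derivative_eq_intros w' simp: Vfun_def field_simps power2_eq_square)
  qed
  ultimately show "has_qvf_mgf M (Binomial_fam n p) i Z"
    unfolding has_qvf_mgf_def
    by (intro conjI exI[of _ "1::real"] exI[of _ "\<lambda>s. w s ^ n i"] exI[of _ \<mu>]) (auto simp: \<mu>_def w_def)
  have "AE \<omega> in M. 0 \<le> n i * Z \<omega> \<and> n i * Z \<omega> \<le> n i"
    by (rule AE_of_distr_eq[OF _ _ law]) (use p in auto)
  then show "AE \<omega> in M. Z \<omega> \<in> mean_space (Binomial_fam n p)"
    using n by (auto elim!: eventually_mono simp: zero_le_mult_iff)
qed

lemma has_qvf_mgf_NegBin:
  assumes "valid_params (NegBin_fam n p)" "has_family_law M (NegBin_fam n p) i Z" "i \<ge> 1"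
  shows "has_qvf_mgf M (NegBin_fam n p) i Z" and "AE \<omega> in M. Z \<omega> \<in> mean_space (NegBin_fam n p)"
proof -
  have n: "n i \<ge> 1" and p: "0 < p i" "p i < 1" using assms by auto
  have [measurable]: "Z \<in> borel_measurable M" and
    law: "distr M borel (\<lambda>\<omega>. n i * Z \<omega>) = distr (measure_pmf (neg_binomial_pmf (n i) (1 - p i))) borel real"
    using assms by auto
  define w where "w = (\<lambda>s. 1 - p i * exp s)"
  define \<delta> where "\<delta> = - ln (p i)"
  have \<delta>: "\<delta> > 0" using p by (simp add: \<delta>_def)
  have w: "w s > 0" if "\<bar>s\<bar> < \<delta>" for s
  proof -
    have "exp s < exp (- ln (p i))" using that by (simp add: \<delta>_def)
    then show ?thesis using p by (simp add: w_def exp_minus field_simps)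
  qed
  define \<phi> where "\<phi> = (\<lambda>s. (1 - p i) ^ n i * (1 / w s) ^ n i)"
  define \<mu> where "\<mu> = (\<lambda>s. p i * exp s / w s)"
  have w': "(w has_real_derivative - (p i * exp s)) (at s)" for s
    unfolding w_def by (auto intro!: derivative_eq_intros)
  have "has_bochner_integral M (\<lambda>\<omega>. exp (s * (n i * Z \<omega>))) (\<phi> s)" if s: "\<bar>s\<bar> < \<delta>" for s
  proof (rule has_bochner_integral_of_distr_eq[OF _ _ law])
    have r: "0 < p i * exp s" "p i * exp s < 1" using w[OF s] p by (auto simp: w_def)
    show "has_bochner_integral (neg_binomial_pmf (n i) (1 - p i)) (\<lambda>k. exp (s * real k)) (\<phi> s)"
      by (rule has_bochner_integral_exp_pmf_tilt[where q' = "neg_binomial_pmf (n i) (1 - p i * exp s)"])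
        (use p r in \<open>simp add: pmf_NegBin \<phi>_def w_def power_mult_distrib field_simps flip: exp_of_nat_mult\<close>)
  qed measurable
  moreover have "(\<phi> has_real_derivative n i * \<mu> s * \<phi> s) (at s)" if s: "\<bar>s\<bar> < \<delta>" for s
  proof -
    have "(\<phi> has_real_derivative (1 - p i) ^ n i * (n i * (1 / w s) ^ (n i - 1) * (p i * exp s / (w s)\<^sup>2))) (at s)"
      unfolding \<phi>_def using w[OF s]
      by (auto intro!: derivative_eq_intros w' simp: power2_eq_square)
    also have "(1 - p i) ^ n i * (n i * (1 / w s) ^ (n i - 1) * (p i * exp s / (w s)\<^sup>2)) = n i * \<mu> s * \<phi> s"
      using w[OF s] n by (cases "n i") (auto simp: \<mu>_def \<phi>_def power2_eq_square)
    finally show ?thesis .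
  qed
  moreover have "(\<mu> has_real_derivative Vfun (NegBin_fam n p) (\<mu> s)) (at s)" if s: "\<bar>s\<bar> < \<delta>" for s
    unfolding \<mu>_def using w[OF s]
    by (auto intro!: derivative_eq_intros w' simp: Vfun_def field_simps power2_eq_square)
  ultimately show "has_qvf_mgf M (NegBin_fam n p) i Z"
    unfolding has_qvf_mgf_def using \<delta>
    by (intro conjI exI[of _ \<delta>] exI[of _ \<phi>] exI[of _ \<mu>]) (auto simp: \<mu>_def w_def)
  have "AE \<omega> in M. n i * Z \<omega> \<ge> 0"
    by (rule AE_of_distr_eq[OF _ _ law]) auto
  then show "AE \<omega> in M. Z \<omega> \<in> mean_space (NegBin_fam n p)"
    using n by (auto elim!: eventually_mono simp: zero_le_mult_iff)
qed

lemma gamma_density_nonneg: "k > 0 \<Longrightarrow> l > 0 \<Longrightarrow> gamma_density k l x \<ge> 0"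
  by (auto simp: gamma_density_def)

lemma gamma_density_measurable [measurable]: "gamma_density k l \<in> borel_measurable borel"
  unfolding gamma_density_def by measurable

text \<open>
  The total mass does not depend on the scale. As the density of the sample is known to have mass one, so
  have the tilted densities, which differ in the scale only.
\<close>

lemma nn_integral_gamma_density_scale:
  assumes "k > 0" "l > 0" "l' > 0"
  shows "(\<integral>\<^sup>+x. gamma_density k l' x \<partial>lborel) = (\<integral>\<^sup>+x. gamma_density k l x \<partial>lborel)"
proof -
  have eq: "gamma_density k l x = l' / l * gamma_density k l' (l' / l * x)" for x
  proof (cases "x > 0")
    case True
    have "l powr k = l * l powr (k - 1)" "l' powr k = l' * l' powr (k - 1)"
      using assms by (simp_all add: powr_diff)
    then show ?thesis
      using True assms by (simp add: gamma_density_def powr_mult powr_divide field_simps zero_less_divide_iff)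
  qed (use assms in \<open>auto simp: gamma_density_def zero_less_divide_iff zero_less_mult_iff\<close>)
  have "(\<integral>\<^sup>+x. gamma_density k l' x \<partial>lborel)
      = ennreal \<bar>l' / l\<bar> * (\<integral>\<^sup>+x. gamma_density k l' (0 + l' / l * x) \<partial>lborel)"
    by (rule nn_integral_real_affine) (use assms in auto)
  also have "\<dots> = (\<integral>\<^sup>+x. ennreal \<bar>l' / l\<bar> * ennreal (gamma_density k l' (l' / l * x)) \<partial>lborel)"
    by (subst nn_integral_cmult) auto
  also have "\<dots> = (\<integral>\<^sup>+x. gamma_density k l x \<partial>lborel)"
    using assms gamma_density_nonneg[of k l'] by (intro nn_integral_cong) (simp add: eq flip: ennreal_mult)
  finally show ?thesis .
qed

lemma (in prob_space) has_qvf_mgf_Gamma: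
  assumes "valid_params (Gamma_fam \<alpha> t l)" "has_family_law M (Gamma_fam \<alpha> t l) i Z" "i \<ge> 1"
  shows "has_qvf_mgf M (Gamma_fam \<alpha> t l) i Z" and "AE \<omega> in M. Z \<omega> \<in> mean_space (Gamma_fam \<alpha> t l)"
proof -
  have pos: "\<alpha> > 0" "t i > 0" "l i > 0" using assms by auto
  define k where "k = t i * \<alpha>"
  have k: "k > 0" using pos by (simp add: k_def)
  have law: "distributed M lborel (\<lambda>\<omega>. t i * Z \<omega>) (\<lambda>x. ennreal (gamma_density k (l i) x))"
    using assms by (simp add: k_def)
  have X [measurable]: "(\<lambda>\<omega>. t i * Z \<omega>) \<in> borel_measurable M"
    using distributed_measurable[OF law] by simp
  have "(\<lambda>\<omega>. (t i * Z \<omega>) / t i) \<in> borel_measurable M"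
    using X by (rule borel_measurable_divide) simp
  then have [measurable]: "Z \<in> borel_measurable M" using pos by simp
  have total: "(\<integral>\<^sup>+x. gamma_density k l' x \<partial>lborel) = 1" if "l' > 0" for l'
  proof -
    have "(\<integral>\<^sup>+x. gamma_density k (l i) x * indicator UNIV x \<partial>lborel) = emeasure M (space M)"
      using distributed_emeasure[OF law, of UNIV] by simp
    then show ?thesis
      using nn_integral_gamma_density_scale[OF k pos(3) that] emeasure_space_1 by simp
  qed
  define w where "w = (\<lambda>s. 1 - l i * s)"
  define \<delta> where "\<delta> = 1 / l i"
  have \<delta>: "\<delta> > 0" using pos by (simp add: \<delta>_def)
  have w: "w s > 0" if "\<bar>s\<bar> < \<delta>" for s
  proof -
    have "l i * s \<le> l i * \<bar>s\<bar>" using pos by (intro mult_left_mono) auto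
    also have "\<dots> < 1" using that pos by (simp add: \<delta>_def field_simps)
    finally show ?thesis by (simp add: w_def)
  qed
  have w': "(w has_real_derivative - l i) (at s)" for s
    unfolding w_def by (auto intro!: derivative_eq_intros)
  define \<phi> where "\<phi> = (\<lambda>s. w s powr (- k))"
  define \<mu> where "\<mu> = (\<lambda>s. \<alpha> * l i / w s)"
  have "has_bochner_integral M (\<lambda>\<omega>. exp (s * (t i * Z \<omega>))) (\<phi> s)" if s: "\<bar>s\<bar> < \<delta>" for s
  proof (rule has_bochner_integral_nn_integral)
    have tilt: "gamma_density k (l i) x * exp (s * x) = \<phi> s * gamma_density k (l i / w s) x" for x
      using w[OF s] pos
      by (auto simp: gamma_density_def \<phi>_def w_def powr_divide powr_minus field_simps simp flip: exp_add)
    have "(\<integral>\<^sup>+\<omega>. ennreal (exp (s * (t i * Z \<omega>))) \<partial>M)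
        = (\<integral>\<^sup>+x. ennreal (gamma_density k (l i) x) * ennreal (exp (s * x)) \<partial>lborel)"
      by (rule distributed_nn_integral[OF law, symmetric]) measurable
    also have "\<dots> = (\<integral>\<^sup>+x. ennreal (\<phi> s) * ennreal (gamma_density k (l i / w s) x) \<partial>lborel)"
      using gamma_density_nonneg[OF k pos(3)]  gamma_density_nonneg[OF k, of "l i / w s"] pos w[OF s]
      by (intro nn_integral_cong) (simp add: tilt \<phi>_def flip: ennreal_mult)
    also have "\<dots> = ennreal (\<phi> s)"
      using w[OF s] pos by (subst nn_integral_cmult) (auto simp: total)
    finally show "(\<integral>\<^sup>+\<omega>. ennreal (exp (s * (t i * Z \<omega>))) \<partial>M) = ennreal (\<phi> s)" .
  qed (auto simp: \<phi>_def)
  moreover have "(\<phi> has_real_derivative t i * \<mu> s * \<phi> s) (at s)" if s: "\<bar>s\<bar> < \<delta>" for s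
    unfolding \<phi>_def using w[OF s]
    by (auto intro!: derivative_eq_intros w' simp: powr_diff \<mu>_def k_def powr_minus field_simps)
  moreover have "(\<mu> has_real_derivative Vfun (Gamma_fam \<alpha> t l) (\<mu> s)) (at s)" if s: "\<bar>s\<bar> < \<delta>" for s
    unfolding \<mu>_def using w[OF s] pos
    by (auto intro!: derivative_eq_intros w' simp: Vfun_def field_simps power2_eq_square)
  ultimately show "has_qvf_mgf M (Gamma_fam \<alpha> t l) i Z"
    unfolding has_qvf_mgf_def using \<delta>
    by (intro conjI exI[of _ \<delta>] exI[of _ \<phi>] exI[of _ \<mu>]) (auto simp: \<mu>_def w_def)
  have "AE x in distr M lborel (\<lambda>\<omega>. t i * Z \<omega>). x \<ge> 0"
    unfolding distributed_distr_eq_density[OF law]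
    by (subst AE_density) (auto simp: gamma_density_def)
  then have "AE \<omega> in M. t i * Z \<omega> \<ge> 0"
    by (subst (asm) AE_distr_iff) auto
  then show "AE \<omega> in M. Z \<omega> \<in> mean_space (Gamma_fam \<alpha> t l)"
    using pos by (auto elim!: eventually_mono simp: zero_le_mult_iff)
qed

lemma has_qvf_mgf_GHS:
  assumes "valid_params (GHS_fam \<alpha> t l)" "has_family_law M (GHS_fam \<alpha> t l) i Z" "i \<ge> 1"
  shows "has_qvf_mgf M (GHS_fam \<alpha> t l) i Z"
proof -
  have pos: "\<alpha> > 0" "t i > 0" using assms by auto
  have X [measurable]: "(\<lambda>\<omega>. t i * Z \<omega>) \<in> borel_measurable M"
    using assms by (auto simp: has_GHS_law_def)
  have "(\<lambda>\<omega>. (t i * Z \<omega>) / t i) \<in> borel_measurable M"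
    using X by (rule borel_measurable_divide) simp
  then have [measurable]: "Z \<in> borel_measurable M" using pos by simp
  define \<eta> where "\<eta> = arctan (l i)"
  define \<delta> where "\<delta> = pi / 2 - \<bar>\<eta>\<bar>"
  have \<delta>: "\<delta> > 0" using arctan_lbound[of "l i"] arctan_ubound[of "l i"] by (auto simp: \<delta>_def \<eta>_def)
  have cos: "cos (\<eta> + s) > 0" if "\<bar>s\<bar> < \<delta>" for s
    using that by (intro cos_gt_zero_pi) (auto simp: \<delta>_def)
  have cos0: "cos \<eta> > 0" using cos[of 0] \<delta> by simp
  define \<phi> where "\<phi> = (\<lambda>s. (cos \<eta> / cos (\<eta> + s)) powr (t i * \<alpha>))"
  define \<mu> where "\<mu> = (\<lambda>s. \<alpha> * tan (\<eta> + s))"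
  have "has_bochner_integral M (\<lambda>\<omega>. exp (s * (t i * Z \<omega>))) (\<phi> s)" if s: "\<bar>s\<bar> < \<delta>" for s
  proof -
    have "\<bar>arctan (l i) + s\<bar> < pi / 2" using s unfolding \<delta>_def \<eta>_def by linarith
    then show ?thesis using assms(2) by (simp add: has_GHS_law_def \<phi>_def \<eta>_def)
  qed
  moreover have "(\<phi> has_real_derivative t i * \<mu> s * \<phi> s) (at s)" if s: "\<bar>s\<bar> < \<delta>" for s
    unfolding \<phi>_def using cos[OF s] cos0
    by (auto intro!: derivative_eq_intros simp: powr_diff \<mu>_def tan_def field_simps power2_eq_square)
  moreover have "(\<mu> has_real_derivative Vfun (GHS_fam \<alpha> t l) (\<mu> s)) (at s)" if s: "\<bar>s\<bar> < \<delta>" for s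
  proof -
    have "(\<mu> has_real_derivative \<alpha> * inverse ((cos (\<eta> + s))\<^sup>2)) (at s)"
      unfolding \<mu>_def using cos[OF s] by (auto intro!: derivative_eq_intros)
    also have "\<alpha> * inverse ((cos (\<eta> + s))\<^sup>2) = Vfun (GHS_fam \<alpha> t l) (\<mu> s)"
      using tan_sec[of "\<eta> + s", symmetric] cos[OF s] pos
      by (simp add: Vfun_def \<mu>_def algebra_simps power2_eq_square)
    finally show ?thesis .
  qed
  ultimately show ?thesis
    unfolding has_qvf_mgf_def using \<delta>
    by (intro conjI exI[of _ \<delta>] exI[of _ \<phi>] exI[of _ \<mu>]) (auto simp: \<mu>_def \<eta>_def tan_arctan)
qed

lemma (in prob_space) family_mgf_and_support:
  assumes "valid_params F" "has_family_law M F i Z" "i \<ge> 1"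
  shows "has_qvf_mgf M F i Z" and "AE \<omega> in M. Z \<omega> \<in> mean_space F"
proof -
  have "has_qvf_mgf M F i Z \<and> (AE \<omega> in M. Z \<omega> \<in> mean_space F)"
  proof (cases F)
    case (Binomial_fam n p)
    show ?thesis
      unfolding Binomial_fam using has_qvf_mgf_Binomial[OF assms[unfolded Binomial_fam]] by (intro conjI)
  next
    case (Poisson_fam t th)
    show ?thesis
      unfolding Poisson_fam using has_qvf_mgf_Poisson[OF assms[unfolded Poisson_fam]] by (intro conjI)
  next
    case (NegBin_fam n p)
    show ?thesis
      unfolding NegBin_fam using has_qvf_mgf_NegBin[OF assms[unfolded NegBin_fam]] by (intro conjI)
  next
    case (Gamma_fam \<alpha> t l)
    show ?thesis
      unfolding Gamma_fam using has_qvf_mgf_Gamma[OF assms[unfolded Gamma_fam]] by (intro conjI)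
  next
    case (GHS_fam \<alpha> t l)
    show ?thesis
      unfolding GHS_fam using has_qvf_mgf_GHS[OF assms[unfolded GHS_fam]] by simp
  qed
  then show "has_qvf_mgf M F i Z" and "AE \<omega> in M. Z \<omega> \<in> mean_space F" by auto
qed

section \<open>Moment bounds for the five families\<close>

lemma cube_add_le:
  fixes x y :: real
  assumes "x \<ge> 0" "y \<ge> 0"
  shows "(x + y) ^ 3 \<le> 4 * (x ^ 3 + y ^ 3)"
proof -
  have "4 * (x ^ 3 + y ^ 3) - (x + y) ^ 3 = 3 * ((x - y)\<^sup>2 * (x + y))"
    by (simp add: eval_nat_numeral algebra_simps)
  moreover have "(x - y)\<^sup>2 * (x + y) \<ge> 0" using assms by simp
  ultimately show ?thesis by linarith
qed

lemma fourth_add_le: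
  fixes x y :: real
  shows "(x + y) ^ 4 \<le> 8 * (x ^ 4 + y ^ 4)"
proof -
  have sq: "(x + y)\<^sup>2 \<le> 2 * (x\<^sup>2 + y\<^sup>2)"
    using sum_squares_bound[of x y] by (simp add: power2_sum)
  have "(x + y) ^ 4 = ((x + y)\<^sup>2)\<^sup>2" by simp
  also have "\<dots> \<le> (2 * (x\<^sup>2 + y\<^sup>2))\<^sup>2"
    by (rule power_mono[OF sq]) simp
  also have "\<dots> \<le> 8 * ((x\<^sup>2)\<^sup>2 + (y\<^sup>2)\<^sup>2)"
    using sum_squares_bound[of "x\<^sup>2" "y\<^sup>2"] by (simp add: power_mult_distrib power2_sum)
  finally show ?thesis by simp
qed

text \<open>
  Three times the squared variance plus the fourth cumulant \<open>V (V'\<^sup>2 + V V'') / \<tau>\<^sup>3\<close>.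
\<close>

definition fourth_moment :: "nef_qvf \<Rightarrow> nat \<Rightarrow> real" where
  "fourth_moment F i = 3 * (Vfun F (theta F i))\<^sup>2 / (tau F i)\<^sup>2
     + ((nu1 F + 2 * nu2 F * theta F i)\<^sup>2 * Vfun F (theta F i) + 2 * nu2 F * (Vfun F (theta F i))\<^sup>2)
       / (tau F i) ^ 3"

text \<open>
  The unbiased estimator of the variance of an observation that enters the risk estimate.
\<close>

definition ure_var :: "nef_qvf \<Rightarrow> nat \<Rightarrow> real \<Rightarrow> real" where
  "ure_var F i y = Vfun F y / (tau F i + nu2 F)"

text \<open>
  A bound for the second moment of the estimated variance, from the expansion of \<open>V\<close> around the mean and
  \<open>(x + y + z)\<^sup>2 \<le> 3 (x\<^sup>2 + y\<^sup>2 + z\<^sup>2)\<close>.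
\<close>

definition ure_var_bound :: "nef_qvf \<Rightarrow> nat \<Rightarrow> real" where
  "ure_var_bound F i = 3 * ((Vfun F (theta F i))\<^sup>2
     + (nu1 F + 2 * nu2 F * theta F i)\<^sup>2 * (Vfun F (theta F i) / tau F i)
     + (nu2 F)\<^sup>2 * fourth_moment F i) / (tau F i + nu2 F)\<^sup>2"

text \<open>
  A single number per observation that dominates every moment used later. The Poisson family satisfies it
  with a cubic polynomial in the mean, the other families with a quartic one, which is why their growth
  conditions differ.
\<close>

definition moment_envelope :: "nef_qvf \<Rightarrow> nat \<Rightarrow> real \<Rightarrow> bool" where
  "moment_envelope F i e \<longleftrightarrow> 1 \<le> e \<and> \<bar>theta F i\<bar> ^ 3 \<le> e \<and> fourth_moment F i \<le> e \<and>
     (theta F i)\<^sup>2 * (Vfun F (theta F i) / tau F i) \<le> e \<and> ure_var_bound F i \<le> e"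

text \<open>
  All the quantities are products of \<open>\<nu>\<^sub>j\<close>, \<open>1 / \<tau>\<close>, \<open>1 / (\<tau> + \<nu>\<^sub>2)\<close>, all at most \<open>c\<close>, with a polynomial
  of degree at most four in the mean; the constant \<open>42 c\<^sup>1\<^sup>0\<close> is what the crude estimates below add up to for
  the worst of them, the second moment of the estimated variance.
\<close>

lemma moment_envelope_quartic:
  assumes c: "1 \<le> c" and tau: "0 < tau F i" "1 / tau F i \<le> c"
    and tau2: "0 < tau F i + nu2 F" "1 / (tau F i + nu2 F) \<le> c"
    and nu: "\<bar>nu0 F\<bar> \<le> c" "\<bar>nu1 F\<bar> \<le> c" "\<bar>nu2 F\<bar> \<le> c"
    and V: "0 \<le> Vfun F (theta F i)"
  shows "moment_envelope F i (42 * c ^ 10 * (1 + \<bar>theta F i\<bar>) ^ 4)"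
proof -
  define Q where "Q = 1 + \<bar>theta F i\<bar>"
  define v where "v = Vfun F (theta F i)"
  define d where "d = nu1 F + 2 * nu2 F * theta F i"
  define x where "x = 1 / tau F i"
  define w where "w = 1 / (tau F i + nu2 F)"
  have Q: "Q \<ge> 1" and v: "v \<ge> 0" and x: "0 \<le> x" "x \<le> c" and w: "0 \<le> w" "w \<le> c"
    using assms by (auto simp: Q_def v_def x_def w_def)
  have cp: "c ^ k \<le> c ^ l" if "k \<le> l" for k l
    using c that by (rule power_increasing[rotated])
  have v_le: "v \<le> c * Q\<^sup>2"
  proof -
    have "v \<le> \<bar>nu0 F\<bar> + \<bar>nu1 F\<bar> * \<bar>theta F i\<bar> + \<bar>nu2 F\<bar> * (theta F i)\<^sup>2"
      unfolding v_def Vfun_def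
      using abs_ge_self[of "nu0 F"] abs_ge_self[of "nu1 F * theta F i"]
        abs_ge_self[of "nu2 F * (theta F i)\<^sup>2"] by (simp add: abs_mult)
    also have "\<dots> \<le> c + c * \<bar>theta F i\<bar> + c * (theta F i)\<^sup>2"
      using nu by (intro add_mono mult_right_mono) auto
    also have "\<dots> \<le> c * Q\<^sup>2"
      using c by (simp add: Q_def power2_sum algebra_simps)
    finally show ?thesis .
  qed
  have "\<bar>d\<bar> \<le> \<bar>nu1 F\<bar> + 2 * \<bar>nu2 F\<bar> * \<bar>theta F i\<bar>"
    unfolding d_def using abs_triangle_ineq[of "nu1 F" "2 * nu2 F * theta F i"] by (simp add: abs_mult)
  also have "\<dots> \<le> c + 2 * c * \<bar>theta F i\<bar>"
    using nu by (intro add_mono mult_right_mono) auto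
  also have "\<dots> \<le> 2 * c * Q" using c by (simp add: Q_def algebra_simps)
  finally have "\<bar>d\<bar>\<^sup>2 \<le> (2 * c * Q)\<^sup>2" by (intro power_mono) auto
  then have d: "d\<^sup>2 \<le> 4 * c\<^sup>2 * Q\<^sup>2" by (simp add: power_mult_distrib)
  have v2: "v\<^sup>2 \<le> c\<^sup>2 * Q ^ 4"
    using power_mono[OF v_le v, of 2] by (simp add: power_mult_distrib flip: power_mult)
  have dv: "d\<^sup>2 * v \<le> 4 * c ^ 3 * Q ^ 4"
    using mult_mono[OF d v_le _ v] c Q by (simp add: eval_nat_numeral mult_ac)
  have "nu2 F * v\<^sup>2 \<le> c * (c\<^sup>2 * Q ^ 4)"
    using nu v2 c by (intro mult_mono) auto
  then have nv: "2 * nu2 F * v\<^sup>2 \<le> 2 * c ^ 3 * Q ^ 4"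
    by (simp add: eval_nat_numeral mult_ac)
  have fm: "fourth_moment F i = 3 * (v\<^sup>2 * x\<^sup>2) + (d\<^sup>2 * v + 2 * nu2 F * v\<^sup>2) * x ^ 3"
    by (simp add: fourth_moment_def v_def d_def x_def power_one_over divide_simps)
  have "v\<^sup>2 * x\<^sup>2 \<le> (c\<^sup>2 * Q ^ 4) * c\<^sup>2"
    using v2 x c by (intro mult_mono power_mono) auto
  also have "\<dots> = c ^ 4 * Q ^ 4" by (simp add: eval_nat_numeral)
  also have "\<dots> \<le> c ^ 6 * Q ^ 4" by (intro mult_right_mono cp) (use Q in auto)
  finally have m1: "v\<^sup>2 * x\<^sup>2 \<le> c ^ 6 * Q ^ 4" .
  have "(d\<^sup>2 * v + 2 * nu2 F * v\<^sup>2) * x ^ 3 \<le> (6 * c ^ 3 * Q ^ 4) * c ^ 3"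
    using dv nv x c by (intro mult_mono power_mono) auto
  also have "\<dots> = 6 * (c ^ 6 * Q ^ 4)" by (simp add: eval_nat_numeral)
  finally have m4: "fourth_moment F i \<le> 9 * (c ^ 6 * Q ^ 4)"
    using m1 by (simp add: fm)
  have t2: "(theta F i)\<^sup>2 * (v * x) \<le> Q\<^sup>2 * ((c * Q\<^sup>2) * c)"
    using v_le x v c power_mono[of "\<bar>theta F i\<bar>" Q 2] by (intro mult_mono) (auto simp: Q_def)
  have "d\<^sup>2 * v * x \<le> (4 * c ^ 3 * Q ^ 4) * c"
    by (rule mult_mono[OF dv x(2) _ x(1)]) (use c Q in simp)
  also have "\<dots> = 4 * (c ^ 4 * Q ^ 4)" by (simp add: eval_nat_numeral)
  also have "\<dots> \<le> 4 * (c ^ 8 * Q ^ 4)" by (intro mult_left_mono mult_right_mono cp) (use Q in auto)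
  finally have w1: "d\<^sup>2 * v * x \<le> 4 * (c ^ 8 * Q ^ 4)" .
  have "(nu2 F)\<^sup>2 * fourth_moment F i \<le> c\<^sup>2 * (9 * (c ^ 6 * Q ^ 4))"
  proof (rule order_trans[OF mult_left_mono[OF m4] mult_right_mono])
    show "(nu2 F)\<^sup>2 \<le> c\<^sup>2" using nu power_mono[of "\<bar>nu2 F\<bar>" c 2] by simp
  qed (use c Q in auto)
  also have "\<dots> = 9 * (c ^ 8 * Q ^ 4)" by (simp add: eval_nat_numeral)
  finally have w2: "(nu2 F)\<^sup>2 * fourth_moment F i \<le> 9 * (c ^ 8 * Q ^ 4)" .
  have w3: "v\<^sup>2 \<le> c ^ 8 * Q ^ 4"
    by (rule order_trans[OF v2], intro mult_right_mono cp) (use Q in auto)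
  have "ure_var_bound F i = 3 * (v\<^sup>2 + d\<^sup>2 * v * x + (nu2 F)\<^sup>2 * fourth_moment F i) * w\<^sup>2"
    by (simp add: ure_var_bound_def v_def d_def x_def w_def power_one_over divide_simps)
  also have "\<dots> \<le> (42 * (c ^ 8 * Q ^ 4)) * c\<^sup>2"
  proof (rule mult_mono)
    show "3 * (v\<^sup>2 + d\<^sup>2 * v * x + (nu2 F)\<^sup>2 * fourth_moment F i) \<le> 42 * (c ^ 8 * Q ^ 4)"
      using mult_left_mono[OF add_mono[OF add_mono[OF w3 w1] w2], of 3] by (simp add: mult.commute)
    show "w\<^sup>2 \<le> c\<^sup>2" using w by (intro power_mono) auto
  qed (use c Q in auto)
  also have "\<dots> = 42 * c ^ 10 * Q ^ 4" by (simp add: eval_nat_numeral)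
  finally have W: "ure_var_bound F i \<le> 42 * c ^ 10 * Q ^ 4" .
  have le: "c ^ k * Q ^ l \<le> c ^ 10 * Q ^ 4" if "k \<le> 10" "l \<le> 4" for k l
    using c Q that by (intro mult_mono power_increasing) auto
  have pos: "0 \<le> c ^ 10 * Q ^ 4" using c Q by simp
  have "\<bar>theta F i\<bar> ^ 3 \<le> Q ^ 3" by (intro power_mono) (auto simp: Q_def)
  then have t3: "\<bar>theta F i\<bar> ^ 3 \<le> c ^ 10 * Q ^ 4" using le[of 0 3] by simp
  have "Q\<^sup>2 * ((c * Q\<^sup>2) * c) = c ^ 2 * Q ^ 4" by (simp add: eval_nat_numeral)
  then show ?thesis
    unfolding moment_envelope_def Q_def[symmetric] v_def[symmetric]
    using le[of 0 0] le[of 2 4] le[of 6 4] t2 t3 m4 W pos by (simp add: x_def)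
qed

text \<open>
  With \<open>V(\<theta>) = \<theta>\<close> every term has degree at most three in the mean, so third powers suffice here.
\<close>

lemma moment_envelope_Poisson:
  assumes c: "1 \<le> c" and t: "0 < t i" "1 / t i \<le> c" and th: "0 < th i"
  shows "moment_envelope (Poisson_fam t th) i (6 * c ^ 3 * (1 + \<bar>th i\<bar>) ^ 3)"
proof -
  define x where "x = 1 / t i"
  define Q where "Q = 1 + th i"
  have Q: "Q \<ge> 1" "th i \<le> Q" and x: "0 \<le> x" "x \<le> c" using assms by (auto simp: Q_def x_def)
  have le: "th i ^ k * x ^ l \<le> c ^ 3 * Q ^ 3" if "k \<le> 3" "l \<le> 3" for k l
  proof -
    have "th i ^ k * x ^ l \<le> Q ^ k * c ^ l"
      using Q x th by (intro mult_mono power_mono) auto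
    also have "\<dots> \<le> Q ^ 3 * c ^ 3"
      using Q c that by (intro mult_mono power_increasing) auto
    finally show ?thesis by (simp add: mult.commute)
  qed
  have fm: "fourth_moment (Poisson_fam t th) i = 3 * (th i ^ 2 * x ^ 2) + th i ^ 1 * x ^ 3"
    by (simp add: fourth_moment_def Vfun_def x_def power_one_over divide_simps)
  have W: "ure_var_bound (Poisson_fam t th) i = 3 * (th i ^ 2 * x ^ 2) + 3 * (th i ^ 1 * x ^ 3)"
    using t by (simp add: ure_var_bound_def Vfun_def x_def power_one_over field_simps eval_nat_numeral)
  have "(th i)\<^sup>2 * (th i / t i) = th i ^ 3 * x ^ 1"
    by (simp add: x_def eval_nat_numeral)
  then have v: "(th i)\<^sup>2 * (th i / t i) \<le> c ^ 3 * Q ^ 3"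
    using le[of 3 1] by linarith
  show ?thesis
    unfolding moment_envelope_def fm W
    using le[of 0 0] le[of 3 0] v le[of 2 2] le[of 1 3] th
    by (simp add: Vfun_def abs_of_pos flip: Q_def)
qed

lemma valid_params_tau_pos: "valid_params F \<Longrightarrow> i \<ge> 1 \<Longrightarrow> 0 < tau F i"
  by (cases F) (auto dest!: spec[of _ i])

lemma valid_params_Vfun_nonneg:
  assumes "valid_params F" "i \<ge> 1"
  shows "0 \<le> Vfun F (theta F i)"
proof (cases F)
  case (Binomial_fam n p)
  then have "0 \<le> p i * (1 - p i)" using assms by (intro mult_nonneg_nonneg) (auto dest!: spec[of _ i])
  then show ?thesis by (simp add: Vfun_def Binomial_fam power2_eq_square algebra_simps)
qed (use assms in \<open>auto simp: Vfun_def dest!: spec[of _ i]\<close>)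

lemma INF_pos_bound:
  fixes f :: "nat \<Rightarrow> real"
  assumes "(INF i\<in>{1..}. f i) > 0" "\<And>i. i \<ge> 1 \<Longrightarrow> 0 < f i" "i \<ge> 1"
  shows "(INF i\<in>{1..}. f i) \<le> f i"
proof (rule cINF_lower)
  show "bdd_below (f ` {1..})" using assms(2) by (intro bdd_belowI[of _ 0]) (auto intro: less_imp_le)
qed (use assms in auto)

lemma eventually_sum_le_of_bigo:
  fixes f g :: "nat \<Rightarrow> real"
  assumes "(\<lambda>p. \<Sum>i=1..p. f i) \<in> O(\<lambda>p. real p)" and "\<And>i. g i = k + l * f i" "0 \<le> l"
  shows "\<exists>C. \<forall>\<^sub>F p in sequentially. (\<Sum>i=1..p. g i) \<le> C * real p"
proof -
  obtain c where c: "\<forall>\<^sub>F p in sequentially. norm (\<Sum>i=1..p. f i) \<le> c * norm (real p)"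
    using assms(1) by (auto elim: landau_o.bigE)
  have "\<forall>\<^sub>F p in sequentially. (\<Sum>i=1..p. g i) \<le> (k + l * c) * real p"
    using c
  proof eventually_elim
    case (elim p)
    have "(\<Sum>i=1..p. g i) = k * real p + l * (\<Sum>i=1..p. f i)"
      by (simp add: assms(2) sum.distrib sum_distrib_left)
    also have "\<dots> \<le> k * real p + l * (c * real p)"
      using elim assms(3) by (intro add_left_mono mult_left_mono) auto
    finally show ?case by (simp add: algebra_simps)
  qed
  then show ?thesis by blast
qed

lemma moment_envelope_mono: "moment_envelope F i a \<Longrightarrow> a \<le> b \<Longrightarrow> moment_envelope F i b"
  by (auto simp: moment_envelope_def)

text \<open>
  Lower bounds on \<open>\<tau>\<close> enter through \<open>1 / \<tau> \<le> c\<close> and \<open>1 / (\<tau> + \<nu>\<^sub>2) \<le> c\<close>. For the binomial family,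
  where \<open>\<tau> + \<nu>\<^sub>2 = n - 1\<close>, this is the role of \<open>n \<ge> 2\<close>; its means are at most one, so the
  envelope is bounded.
\<close>

lemma family_moment_envelope:
  assumes valid: "valid_params F" and cond: "family_condition F"
  obtains e C where "\<And>i. i \<ge> 1 \<Longrightarrow> 0 < tau F i + nu2 F \<and> moment_envelope F i (e i)"
    and "\<forall>\<^sub>F p in sequentially. (\<Sum>i=1..p. e i) \<le> C * real p"
proof -
  note envelopeI = that
  note tau = valid_params_tau_pos[OF valid] and V = valid_params_Vfun_nonneg[OF valid]
  have quartic: thesis
    if c: "1 \<le> c" and tau: "\<And>i. i \<ge> 1 \<Longrightarrow> 1 / tau F i \<le> c \<and> 0 < tau F i + nu2 F \<and> 1 / (tau F i + nu2 F) \<le> c"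
      and nu: "\<bar>nu0 F\<bar> \<le> c" "\<bar>nu1 F\<bar> \<le> c" "\<bar>nu2 F\<bar> \<le> c"
      and \<theta>: "\<And>i. (theta F i) ^ 4 = l * f i" "0 \<le> l"
      and f: "(\<lambda>p. \<Sum>i=1..p. f i) \<in> O(\<lambda>p. real p)" for c l f
  proof -
    define e where "e = (\<lambda>i. 42 * c ^ 10 * 8 + 42 * c ^ 10 * 8 * l * f i)"
    have e: "moment_envelope F i (e i)" if "i \<ge> 1" for i
    proof (rule moment_envelope_mono[OF moment_envelope_quartic[OF c]])
      have "(1 + \<bar>theta F i\<bar>) ^ 4 \<le> 8 * (1 + l * f i)"
        using fourth_add_le[of 1 "\<bar>theta F i\<bar>"] \<theta>(1)[of i] by simp
      then have "42 * c ^ 10 * (1 + \<bar>theta F i\<bar>) ^ 4 \<le> 42 * c ^ 10 * (8 * (1 + l * f i))"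
        using c by (intro mult_left_mono) auto
      also have "\<dots> = e i" by (simp add: e_def algebra_simps)
      finally show "42 * c ^ 10 * (1 + \<bar>theta F i\<bar>) ^ 4 \<le> e i" .
    qed (use tau[OF that] valid_params_tau_pos[OF valid that] nu V[OF that] in auto)
    obtain C where "\<forall>\<^sub>F p in sequentially. (\<Sum>i=1..p. e i) \<le> C * real p"
      using eventually_sum_le_of_bigo[OF f, of e] c \<theta>(2) unfolding e_def by fastforce
    with e tau show thesis by (intro envelopeI) auto
  qed
  show thesis
  proof (cases F)
    case (Binomial_fam n p)
    have n: "real (n i) \<ge> 2" if "i \<ge> 1" for i using cond that by (auto simp: Binomial_fam dest!: spec[of _ i])
    define f where "f = (\<lambda>i. p i ^ 4)"
    have "(\<lambda>m. \<Sum>i=1..m. f i) \<in> O(\<lambda>m. real m)"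
    proof (rule bigoI[where c = 1], rule always_eventually, rule allI)
      fix m
      have "(\<Sum>i=1..m. f i) \<le> (\<Sum>i=1..m. 1)"
        using valid by (intro sum_mono) (auto simp: Binomial_fam f_def intro!: power_le_one intro: less_imp_le)
      moreover have "0 \<le> (\<Sum>i=1..m. f i)" by (intro sum_nonneg) (auto simp: f_def)
      ultimately show "norm (\<Sum>i=1..m. f i) \<le> 1 * norm (real m)" by simp
    qed
    moreover have "1 / tau F i \<le> 1 \<and> 0 < tau F i + nu2 F \<and> 1 / (tau F i + nu2 F) \<le> 1" if "i \<ge> 1" for i
      using n[OF that] by (simp add: Binomial_fam)
    ultimately show thesis
      using n by (intro quartic[of 1 1 f]) (auto simp: Binomial_fam f_def)
  next
    case (NegBin_fam n p)
    have n: "real (n i) \<ge> 1" if "i \<ge> 1" for i using valid that by (auto simp: NegBin_fam dest!: spec[of _ i])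
    have "1 / tau F i \<le> 1 \<and> 0 < tau F i + nu2 F \<and> 1 / (tau F i + nu2 F) \<le> 1" if "i \<ge> 1" for i
      using n[OF that] by (simp add: NegBin_fam)
    then show thesis
      using cond by (intro quartic[of 1 1 "\<lambda>i. (p i / (1 - p i)) ^ 4"]) (auto simp: NegBin_fam)
  next
    case (Gamma_fam \<alpha> t l)
    define t0 where "t0 = (INF i\<in>{1..}. t i)"
    have \<alpha>: "\<alpha> > 0" and t0: "t0 > 0" using valid cond by (auto simp: Gamma_fam t0_def)
    have t: "t0 \<le> t i" if "i \<ge> 1" for i
      using INF_pos_bound[of t i] valid cond that by (auto simp: Gamma_fam t0_def)
    define c where "c = 1 + 1 / t0 + 1 / \<alpha> + \<alpha>"
    have inv: "1 / t i \<le> c" "1 / (t i + 1 / \<alpha>) \<le> c" if "i \<ge> 1" for i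
      using \<alpha> t0 t[OF that] frac_le[of 1 1 t0 "t i"] frac_le[of 1 1 t0 "t i + 1 / \<alpha>"]
      by (auto simp: c_def add_increasing2 intro: order_trans)
    show thesis
      using \<alpha> t0 inv cond tau
      by (intro quartic[of c "\<alpha> ^ 4" "\<lambda>i. l i ^ 4"])
        (auto simp: Gamma_fam power_mult_distrib c_def intro!: add_pos_pos)
  next
    case (GHS_fam \<alpha> t l)
    define t0 where "t0 = (INF i\<in>{1..}. t i)"
    have \<alpha>: "\<alpha> > 0" and t0: "t0 > 0" using valid cond by (auto simp: GHS_fam t0_def)
    have t: "t0 \<le> t i" if "i \<ge> 1" for i
      using INF_pos_bound[of t i] valid cond that by (auto simp: GHS_fam t0_def)
    define c where "c = 1 + 1 / t0 + 1 / \<alpha> + \<alpha>"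
    have inv: "1 / t i \<le> c" "1 / (t i + 1 / \<alpha>) \<le> c" if "i \<ge> 1" for i
      using \<alpha> t0 t[OF that] frac_le[of 1 1 t0 "t i"] frac_le[of 1 1 t0 "t i + 1 / \<alpha>"]
      by (auto simp: c_def add_increasing2 intro: order_trans)
    show thesis
      using \<alpha> t0 inv cond tau
      by (intro quartic[of c "\<alpha> ^ 4" "\<lambda>i. l i ^ 4"])
        (auto simp: GHS_fam power_mult_distrib c_def intro!: add_pos_pos)
  next
    case (Poisson_fam t th)
    define t0 where "t0 = (INF i\<in>{1..}. t i)"
    have t0: "t0 > 0" using cond by (auto simp: Poisson_fam t0_def)
    have t: "t0 \<le> t i" if "i \<ge> 1" for i
      using INF_pos_bound[of t i] valid cond that by (auto simp: Poisson_fam t0_def)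
    define c where "c = 1 + 1 / t0"
    have c: "1 \<le> c" using t0 by (simp add: c_def)
    define e where "e = (\<lambda>i. 6 * c ^ 3 * 4 + 6 * c ^ 3 * 4 * th i ^ 3)"
    have e: "moment_envelope F i (e i)" if "i \<ge> 1" for i
    proof -
      have th: "0 < th i" "0 < t i" using valid that by (auto simp: Poisson_fam)
      have "1 / t i \<le> c" using t0 t[OF that] frac_le[of 1 1 t0 "t i"] by (simp add: c_def)
      then have "moment_envelope F i (6 * c ^ 3 * (1 + \<bar>th i\<bar>) ^ 3)"
        using th c unfolding Poisson_fam by (intro moment_envelope_Poisson)
      moreover have "(1 + \<bar>th i\<bar>) ^ 3 \<le> 4 * (1 + th i ^ 3)"
        using cube_add_le[of 1 "th i"] th by simp
      then have "6 * c ^ 3 * (1 + \<bar>th i\<bar>) ^ 3 \<le> 6 * c ^ 3 * (4 * (1 + th i ^ 3))"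
        using c by (intro mult_left_mono) auto
      then have "6 * c ^ 3 * (1 + \<bar>th i\<bar>) ^ 3 \<le> e i" by (simp add: e_def algebra_simps)
      ultimately show ?thesis by (rule moment_envelope_mono)
    qed
    have "(\<lambda>p. \<Sum>i=1..p. th i ^ 3) \<in> O(\<lambda>p. real p)" using cond by (simp add: Poisson_fam)
    then obtain C where "\<forall>\<^sub>F p in sequentially. (\<Sum>i=1..p. e i) \<le> C * real p"
      using eventually_sum_le_of_bigo[of "\<lambda>i. th i ^ 3" e] c unfolding e_def by fastforce
    with e tau show thesis by (intro envelopeI) (auto simp: Poisson_fam)
  qed
qed

lemma (in prob_space) has_qvf_mgf_central_moments:
  assumes mgf: "has_qvf_mgf M F i Z" and tau: "0 < tau F i"
  shows "has_bochner_integral M (\<lambda>\<omega>. Z \<omega> - theta F i) 0"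
    and "has_bochner_integral M (\<lambda>\<omega>. (Z \<omega> - theta F i)\<^sup>2) (Vfun F (theta F i) / tau F i)"
    and "has_bochner_integral M (\<lambda>\<omega>. (Z \<omega> - theta F i) ^ 4) (fourth_moment F i)"
proof -
  obtain \<delta> \<phi> \<mu> where "Z \<in> borel_measurable M" "\<delta> > 0" and \<mu>0: "\<mu> 0 = theta F i"
    and "\<And>s. \<bar>s\<bar> < \<delta> \<Longrightarrow> has_bochner_integral M (\<lambda>\<omega>. exp (s * (tau F i * Z \<omega>))) (\<phi> s)"
    and "\<And>s. \<bar>s\<bar> < \<delta> \<Longrightarrow> (\<phi> has_real_derivative tau F i * \<mu> s * \<phi> s) (at s)"
    and "\<And>s. \<bar>s\<bar> < \<delta> \<Longrightarrow> (\<mu> has_real_derivative Vfun F (\<mu> s)) (at s)"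
    using mgf unfolding has_qvf_mgf_def by blast
  note mom = qvf_central_moments[of Z "tau F i" \<delta> \<phi> \<mu> "nu0 F" "nu1 F" "nu2 F", folded Vfun_def, unfolded \<mu>0,
      OF this(1) tau this(2) this(4-6)]
  show "has_bochner_integral M (\<lambda>\<omega>. Z \<omega> - theta F i) 0" by (rule mom(1))
  show "has_bochner_integral M (\<lambda>\<omega>. (Z \<omega> - theta F i)\<^sup>2) (Vfun F (theta F i) / tau F i)" by (rule mom(2))
  show "has_bochner_integral M (\<lambda>\<omega>. (Z \<omega> - theta F i) ^ 4) (fourth_moment F i)"
    unfolding fourth_moment_def by (rule mom(3))
qed

section \<open>A maximal inequality for monotone weights\<close>

text \<open>
  The squared sums over those dyadic blocks of the \<open>2 ^ n\<close> terms starting at \<open>a\<close> that are left halves of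
  larger blocks. Every proper initial segment is a disjoint union of such blocks, at most one of each
  length.
\<close>

fun dyadic_energy :: "(nat \<Rightarrow> real) \<Rightarrow> nat \<Rightarrow> nat \<Rightarrow> real" where
  "dyadic_energy z 0 a = 0"
| "dyadic_energy z (Suc n) a =
     (\<Sum>i=a..<a + 2 ^ n. z i)\<^sup>2 + dyadic_energy z n a + dyadic_energy z n (a + 2 ^ n)"

lemma dyadic_energy_nonneg: "dyadic_energy z n a \<ge> 0"
  by (induction n arbitrary: a) auto

text \<open>
  The weighted form of Cauchy and Schwarz that adds one more block: a sum of \<open>n + 1\<close> terms has square at
  most \<open>n + 1\<close> times the sum of squares.
\<close>

lemma weighted_square_add_le:
  fixes t s r :: real
  assumes "s\<^sup>2 \<le> real n * r" "r \<ge> 0"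
  shows "(t + s)\<^sup>2 \<le> real (Suc n) * (t\<^sup>2 + r)"
proof (cases "n = 0")
  case True
  then show ?thesis using assms by simp
next
  case False
  have "2 * t * s \<le> real n * t\<^sup>2 + s\<^sup>2 / real n"
    using False sum_squares_ge_zero[of 0 "real n * t - s"]
    by (simp add: field_simps power2_eq_square)
  moreover have "s\<^sup>2 / real n \<le> r"
    using assms False by (simp add: field_simps)
  ultimately show ?thesis
    using assms by (simp add: power2_sum algebra_simps)
qed

text \<open>
  The bound holds for all partial sums simultaneously, with a right-hand side that does not depend on \<open>j\<close>.
  A segment that reaches beyond the left half consists of the whole left half and a segment of the right
  half.
\<close>

lemma partial_sum_square_le_dyadic_energy:
  assumes "j < 2 ^ n"
  shows "(\<Sum>i=a..<a + j. z i)\<^sup>2 \<le> real n * dyadic_energy z n a"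
  using assms
proof (induction n arbitrary: a j)
  case 0
  then show ?case by simp
next
  case (Suc n)
  define t where "t = (\<Sum>i=a..<a + 2 ^ n. z i)"
  show ?case
  proof (cases "j < 2 ^ n")
    case True
    have "(\<Sum>i=a..<a + j. z i)\<^sup>2 \<le> real n * dyadic_energy z n a"
      by (rule Suc.IH[OF True])
    also have "\<dots> \<le> real (Suc n) * dyadic_energy z (Suc n) a"
      by (rule mult_mono) (auto simp: dyadic_energy_nonneg)
    finally show ?thesis .
  next
    case False
    define k where "k = j - 2 ^ n"
    have j: "j = 2 ^ n + k" "k < 2 ^ n" using False Suc.prems by (auto simp: k_def)
    have "(\<Sum>i=a..<a + j. z i) = t + (\<Sum>i=a + 2 ^ n..<a + 2 ^ n + k. z i)"
      unfolding t_def j(1) by (simp add: sum.atLeastLessThan_concat add.assoc)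
    also have "\<dots>\<^sup>2 \<le> real (Suc n) * (t\<^sup>2 + dyadic_energy z n (a + 2 ^ n))"
      by (intro weighted_square_add_le Suc.IH dyadic_energy_nonneg j)
    also have "\<dots> \<le> real (Suc n) * dyadic_energy z (Suc n) a"
      by (rule mult_left_mono) (auto simp: t_def dyadic_energy_nonneg)
    finally show ?thesis .
  qed
qed

text \<open>
  Summation by parts: a sum with decreasing weights in \<open>[0, 1]\<close> is a subconvex combination of the partial
  sums of the unweighted terms.
\<close>

lemma antitone_weighted_sum_le:
  fixes c z :: "nat \<Rightarrow> real"
  assumes "\<And>j. j \<le> p \<Longrightarrow> \<bar>\<Sum>k<j. z k\<bar> \<le> A"
    and "\<And>j k. j \<le> k \<Longrightarrow> k < p \<Longrightarrow> c k \<le> c j"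
    and "\<And>k. k < p \<Longrightarrow> 0 \<le> c k \<and> c k \<le> 1"
  shows "\<bar>\<Sum>k<p. c k * z k\<bar> \<le> A"
proof (cases p)
  case 0
  then show ?thesis using assms(1)[of 0] by simp
next
  case (Suc q)
  have A: "A \<ge> 0" using assms(1)[of 0] by simp
  \<comment> \<open>The part of the summation by parts that comes from the increments of the weights.\<close>
  have "\<bar>(\<Sum>k<Suc n. c k * z k) - c n * (\<Sum>k<Suc n. z k)\<bar> \<le> (c 0 - c n) * A" if "n \<le> q" for n
    using that
  proof (induction n)
    case 0
    then show ?case by simp
  next
    case (Suc n)
    have "(\<Sum>k<Suc (Suc n). c k * z k) - c (Suc n) * (\<Sum>k<Suc (Suc n). z k)
        = ((\<Sum>k<Suc n. c k * z k) - c n * (\<Sum>k<Suc n. z k))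
          + (c n - c (Suc n)) * (\<Sum>k<Suc n. z k)"
      by (simp add: algebra_simps)
    also have "\<bar>\<dots>\<bar> \<le> (c 0 - c n) * A + (c n - c (Suc n)) * A"
    proof (rule order_trans[OF abs_triangle_ineq add_mono])
      have "c (Suc n) \<le> c n" using assms(2)[of n "Suc n"] Suc.prems \<open>p = Suc q\<close> by simp
      then show "\<bar>(c n - c (Suc n)) * (\<Sum>k<Suc n. z k)\<bar> \<le> (c n - c (Suc n)) * A"
        unfolding abs_mult using assms(1)[of "Suc n"] Suc.prems \<open>p = Suc q\<close>
        by (intro mult_mono) auto
    qed (use Suc in simp)
    finally show ?case by (simp add: algebra_simps)
  qed
  from this[of q] have "\<bar>(\<Sum>k<p. c k * z k) - c q * (\<Sum>k<p. z k)\<bar> \<le> (c 0 - c q) * A"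
    by (simp add: Suc)
  moreover have "\<bar>c q * (\<Sum>k<p. z k)\<bar> \<le> c q * A"
    unfolding abs_mult using assms(1)[of p] assms(3)[of q] Suc by (intro mult_mono) auto
  ultimately have "\<bar>\<Sum>k<p. c k * z k\<bar> \<le> (c 0 - c q) * A + c q * A"
    by linarith
  also have "\<dots> = c 0 * A" by (simp add: algebra_simps)
  also have "\<dots> \<le> A"
    using A assms(3)[of 0] Suc by (simp add: mult_left_le_one_le)
  finally show ?thesis .
qed

lemma sorting_bijection:
  fixes t :: "nat \<Rightarrow> real"
  obtains \<sigma> where "bij_betw \<sigma> {..<p} {1..p}" "\<And>j k. j \<le> k \<Longrightarrow> k < p \<Longrightarrow> t (\<sigma> j) \<le> t (\<sigma> k)"
proof
  let ?xs = "sort_key t [1..<Suc p]"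
  show "bij_betw (\<lambda>k. ?xs ! k) {..<p} {1..p}"
    by (rule bij_betw_nth) (auto simp del: upt_Suc)
  show "t (?xs ! j) \<le> t (?xs ! k)" if "j \<le> k" "k < p" for j k
    using sorted_nth_mono[OF sorted_sort_key[of t "[1..<Suc p]"], of j k] that
    by (simp del: upt_Suc)
qed

context prob_space
begin

definition orthogonal_on :: "nat set \<Rightarrow> (nat \<Rightarrow> 'a \<Rightarrow> real) \<Rightarrow> bool" where
  "orthogonal_on I Z \<longleftrightarrow> (\<forall>i\<in>I. \<forall>j\<in>I. integrable M (\<lambda>\<omega>. Z i \<omega> * Z j \<omega>) \<and>
     (i \<noteq> j \<longrightarrow> expectation (\<lambda>\<omega>. Z i \<omega> * Z j \<omega>) = 0))"

lemma orthogonal_sum_square: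
  assumes "orthogonal_on I Z" "finite S" "S \<subseteq> I"
  shows "has_bochner_integral M (\<lambda>\<omega>. (\<Sum>i\<in>S. Z i \<omega>)\<^sup>2) (\<Sum>i\<in>S. expectation (\<lambda>\<omega>. (Z i \<omega>)\<^sup>2))"
proof -
  have "has_bochner_integral M (\<lambda>\<omega>. \<Sum>i\<in>S. \<Sum>j\<in>S. Z i \<omega> * Z j \<omega>)
      (\<Sum>i\<in>S. \<Sum>j\<in>S. expectation (\<lambda>\<omega>. Z i \<omega> * Z j \<omega>))"
    using assms unfolding orthogonal_on_def
    by (intro has_bochner_integral_sum) (auto intro!: has_bochner_integral_integrable)
  also have "(\<lambda>\<omega>. \<Sum>i\<in>S. \<Sum>j\<in>S. Z i \<omega> * Z j \<omega>) = (\<lambda>\<omega>. (\<Sum>i\<in>S. Z i \<omega>)\<^sup>2)"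
    by (simp add: power2_eq_square sum_product)
  also have "(\<Sum>i\<in>S. \<Sum>j\<in>S. expectation (\<lambda>\<omega>. Z i \<omega> * Z j \<omega>))
      = (\<Sum>i\<in>S. expectation (\<lambda>\<omega>. (Z i \<omega>)\<^sup>2))"
  proof (rule sum.cong[OF refl])
    fix i assume "i \<in> S"
    have "(\<Sum>j\<in>S. expectation (\<lambda>\<omega>. Z i \<omega> * Z j \<omega>))
        = (\<Sum>j\<in>S. if j = i then expectation (\<lambda>\<omega>. (Z i \<omega>)\<^sup>2) else 0)"
      using assms \<open>i \<in> S\<close> unfolding orthogonal_on_def
      by (intro sum.cong refl) (auto simp: power2_eq_square subset_eq)
    then show "(\<Sum>j\<in>S. expectation (\<lambda>\<omega>. Z i \<omega> * Z j \<omega>)) = expectation (\<lambda>\<omega>. (Z i \<omega>)\<^sup>2)"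
      using assms \<open>i \<in> S\<close> by simp
  qed
  finally show ?thesis .
qed

text \<open>
  Each of the \<open>n\<close> lengths of blocks contributes at most the sum of all variances, since blocks of the same
  length are disjoint.
\<close>

lemma dyadic_energy_expectation:
  assumes "orthogonal_on UNIV Z"
  shows "integrable M (\<lambda>\<omega>. dyadic_energy (\<lambda>i. Z i \<omega>) n a)"
    and "expectation (\<lambda>\<omega>. dyadic_energy (\<lambda>i. Z i \<omega>) n a)
      \<le> real n * (\<Sum>i=a..<a + 2 ^ n. expectation (\<lambda>\<omega>. (Z i \<omega>)\<^sup>2))"
proof (induction n arbitrary: a)
  case 0
  { case 1 show ?case by simp }
  { case 2 show ?case by simp }
next
  case (Suc n)
  note sq = orthogonal_sum_square[OF assms, of "{a..<a + 2 ^ n}" for a, simplified]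
  { case 1
    show ?case
      using sq[of a] Suc by (auto simp: has_bochner_integral_iff) }
  { case 2
    let ?v = "\<lambda>i. expectation (\<lambda>\<omega>. (Z i \<omega>)\<^sup>2)"
    have "(\<Sum>i=a..<a + 2 ^ Suc n. ?v i)
        = (\<Sum>i=a..<a + 2 ^ n. ?v i) + (\<Sum>i=a + 2 ^ n..<a + 2 ^ n + 2 ^ n. ?v i)"
      by (simp add: sum.atLeastLessThan_concat mult_2 add.assoc)
    moreover have "(\<Sum>i=a + 2 ^ n..<a + 2 ^ n + 2 ^ n. ?v i) \<ge> 0"
      by (intro sum_nonneg) simp
    moreover have "expectation (\<lambda>\<omega>. dyadic_energy (\<lambda>i. Z i \<omega>) (Suc n) a)
       = (\<Sum>i=a..<a + 2 ^ n. ?v i) + expectation (\<lambda>\<omega>. dyadic_energy (\<lambda>i. Z i \<omega>) n a)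
         + expectation (\<lambda>\<omega>. dyadic_energy (\<lambda>i. Z i \<omega>) n (a + 2 ^ n))"
      using sq[of a] Suc(1) by (simp add: has_bochner_integral_iff)
    ultimately show ?case
      using Suc(2)[of a] Suc(2)[of "a + 2 ^ n"] by (simp add: algebra_simps) }
qed

text \<open>
  The random variable \<open>Q\<close> dominates the squared weighted sums for all weights at once that decrease in \<open>t\<close>:
  sort the indices by \<open>t\<close>, which makes all of these weights decreasing sequences, then combine summation by
  parts with the dyadic bound for the largest partial sum.
\<close>

lemma monotone_weights_maximal:
  fixes t :: "nat \<Rightarrow> real"
  assumes orth: "orthogonal_on {1..p} Z" and "p < 2 ^ n"
  obtains Q where "integrable M Q"
    and "expectation Q \<le> (real n)\<^sup>2 * (\<Sum>i=1..p. expectation (\<lambda>\<omega>. (Z i \<omega>)\<^sup>2))"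
    and "\<And>\<omega> b. (\<And>i. i \<in> {1..p} \<Longrightarrow> 0 \<le> b i \<and> b i \<le> 1) \<Longrightarrow>
           (\<And>i j. i \<in> {1..p} \<Longrightarrow> j \<in> {1..p} \<Longrightarrow> t i \<le> t j \<Longrightarrow> b j \<le> b i) \<Longrightarrow>
           (\<Sum>i=1..p. b i * Z i \<omega>)\<^sup>2 \<le> Q \<omega>"
proof -
  obtain \<sigma> where \<sigma>: "bij_betw \<sigma> {..<p} {1..p}"
    and mono: "\<And>j k. j \<le> k \<Longrightarrow> k < p \<Longrightarrow> t (\<sigma> j) \<le> t (\<sigma> k)"
    using sorting_bijection by blast
  have \<sigma>_in: "\<sigma> k \<in> {1..p}" if "k < p" for k using bij_betwE[OF \<sigma>] that by auto
  \<comment> \<open>The sorted sequence, padded with zeros to length \<open>2 ^ n\<close>.\<close>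
  define z where "z = (\<lambda>k \<omega>. if k < p then Z (\<sigma> k) \<omega> else 0)"
  have z: "orthogonal_on UNIV z"
    unfolding orthogonal_on_def
  proof (intro ballI)
    fix j k
    show "integrable M (\<lambda>\<omega>. z j \<omega> * z k \<omega>) \<and>
        (j \<noteq> k \<longrightarrow> expectation (\<lambda>\<omega>. z j \<omega> * z k \<omega>) = 0)"
    proof (cases "j < p \<and> k < p")
      case True
      then have "\<sigma> j \<noteq> \<sigma> k" if "j \<noteq> k"
        using bij_betw_imp_inj_on[OF \<sigma>] that by (auto dest: inj_onD)
      then show ?thesis
        using True orth \<sigma>_in[of j] \<sigma>_in[of k] by (auto simp: orthogonal_on_def z_def)
    qed (auto simp: z_def)
  qed
  define Q where "Q = (\<lambda>\<omega>. real n * dyadic_energy (\<lambda>k. z k \<omega>) n 0)"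
  show thesis
  proof (rule that)
    show "integrable M Q"
      unfolding Q_def using dyadic_energy_expectation(1)[OF z] by simp
    have "(\<Sum>k<2 ^ n. expectation (\<lambda>\<omega>. (z k \<omega>)\<^sup>2)) = (\<Sum>k<p. expectation (\<lambda>\<omega>. (Z (\<sigma> k) \<omega>)\<^sup>2))"
      by (rule sum.mono_neutral_cong_right) (use \<open>p < 2 ^ n\<close> in \<open>auto simp: z_def\<close>)
    also have "\<dots> = (\<Sum>i=1..p. expectation (\<lambda>\<omega>. (Z i \<omega>)\<^sup>2))"
      by (rule sum.reindex_bij_betw[OF \<sigma>])
    finally show "expectation Q \<le> (real n)\<^sup>2 * (\<Sum>i=1..p. expectation (\<lambda>\<omega>. (Z i \<omega>)\<^sup>2))"
      unfolding Q_def using dyadic_energy_expectation(2)[OF z, of n 0]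
      by (simp add: power2_eq_square mult.assoc mult_left_mono lessThan_atLeast0)
    fix \<omega> and b :: "nat \<Rightarrow> real"
    assume b: "\<And>i. i \<in> {1..p} \<Longrightarrow> 0 \<le> b i \<and> b i \<le> 1"
      and b_mono: "\<And>i j. i \<in> {1..p} \<Longrightarrow> j \<in> {1..p} \<Longrightarrow> t i \<le> t j \<Longrightarrow> b j \<le> b i"
    have Q: "Q \<omega> \<ge> 0" by (simp add: Q_def dyadic_energy_nonneg)
    have "\<bar>\<Sum>k<p. b (\<sigma> k) * z k \<omega>\<bar> \<le> sqrt (Q \<omega>)"
    proof (rule antitone_weighted_sum_le)
      fix j assume "j \<le> p"
      then have "j < 2 ^ n" using \<open>p < 2 ^ n\<close> by simp
      from partial_sum_square_le_dyadic_energy[OF this, of "\<lambda>k. z k \<omega>" 0]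
      show "\<bar>\<Sum>k<j. z k \<omega>\<bar> \<le> sqrt (Q \<omega>)"
        by (simp add: Q_def real_le_rsqrt lessThan_atLeast0)
    qed (use b b_mono mono \<sigma>_in in auto)
    also have "(\<Sum>k<p. b (\<sigma> k) * z k \<omega>) = (\<Sum>k<p. b (\<sigma> k) * Z (\<sigma> k) \<omega>)"
      by (simp add: z_def)
    also have "\<dots> = (\<Sum>i=1..p. b i * Z i \<omega>)"
      by (rule sum.reindex_bij_betw[OF \<sigma>])
    finally have "\<bar>\<Sum>i=1..p. b i * Z i \<omega>\<bar>\<^sup>2 \<le> (sqrt (Q \<omega>))\<^sup>2"
      by (rule power_mono) simp
    then show "(\<Sum>i=1..p. b i * Z i \<omega>)\<^sup>2 \<le> Q \<omega>"
      using Q by simp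
  qed
qed

lemma orthogonal_on_indep_centred:
  fixes Y :: "nat \<Rightarrow> 'a \<Rightarrow> real" and f :: "nat \<Rightarrow> real \<Rightarrow> real"
  assumes "indep_vars (\<lambda>_. borel) Y I" and "\<And>i. i \<in> I \<Longrightarrow> f i \<in> borel_measurable borel"
    and "\<And>i. i \<in> I \<Longrightarrow> has_bochner_integral M (\<lambda>\<omega>. f i (Y i \<omega>)) 0"
    and "\<And>i. i \<in> I \<Longrightarrow> integrable M (\<lambda>\<omega>. (f i (Y i \<omega>))\<^sup>2)"
  shows "orthogonal_on I (\<lambda>i \<omega>. f i (Y i \<omega>))"
  unfolding orthogonal_on_def
proof (intro ballI)
  fix i j assume ij: "i \<in> I" "j \<in> I"
  show "integrable M (\<lambda>\<omega>. f i (Y i \<omega>) * f j (Y j \<omega>)) \<and>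
      (i \<noteq> j \<longrightarrow> expectation (\<lambda>\<omega>. f i (Y i \<omega>) * f j (Y j \<omega>)) = 0)"
  proof (cases "i = j")
    case True
    then show ?thesis using assms(4) ij by (simp add: power2_eq_square)
  next
    case False
    have "indep_vars (\<lambda>_. borel) (\<lambda>i \<omega>. f i (Y i \<omega>)) {i, j}"
      by (rule indep_vars_compose2[where M' = "\<lambda>_. borel"])
        (use indep_vars_subset[OF assms(1)] assms(2) ij in auto)
    then have "has_bochner_integral M (\<lambda>\<omega>. \<Prod>k\<in>{i, j}. f k (Y k \<omega>))
        (\<Prod>k\<in>{i, j}. expectation (\<lambda>\<omega>. f k (Y k \<omega>)))"
      using indep_vars_lebesgue_integral[of "{i, j}" "\<lambda>i \<omega>. f i (Y i \<omega>)"]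
        indep_vars_integrable[of "{i, j}" "\<lambda>i \<omega>. f i (Y i \<omega>)"] assms(3) ij
      by (auto simp: has_bochner_integral_iff)
    then show ?thesis
      using False assms(3)[OF ij(1)] by (simp add: has_bochner_integral_iff)
  qed
qed

end

section \<open>The gap between the risk estimate and the loss\<close>

text \<open>
  The weight of the shrinkage target, extended continuously to \<open>g = \<infinity>\<close>; with it, the estimator and the
  risk estimate are given by the same formulas for finite and infinite \<open>g\<close>.
\<close>

definition shrink_weight :: "nef_qvf \<Rightarrow> ennreal \<Rightarrow> nat \<Rightarrow> real" where
  "shrink_weight F g i = (if g = \<infinity> then 1 else enn2real g / (tau F i + enn2real g))"

lemma shrink_weight_bounds: "0 < tau F i \<Longrightarrow> 0 \<le> shrink_weight F g i \<and> shrink_weight F g i \<le> 1"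
  by (auto simp: shrink_weight_def divide_le_eq_1 add_pos_nonneg)

lemma shrink_weight_antimono:
  assumes "0 < tau F i" "tau F i \<le> tau F j"
  shows "shrink_weight F g j \<le> shrink_weight F g i"
  using assms by (auto simp: shrink_weight_def intro!: divide_left_mono mult_pos_pos add_pos_nonneg)

lemma shrinkage_eq_weight:
  assumes "0 < tau F i"
  shows "shrinkage F y g m i = (1 - shrink_weight F g i) * y i + shrink_weight F g i * m"
proof (cases "g = \<infinity>")
  case False
  have "tau F i + enn2real g > 0" using assms by (simp add: add_pos_nonneg)
  then have "tau F i / (tau F i + enn2real g) = 1 - shrink_weight F g i"
    using False by (simp add: shrink_weight_def field_simps)
  then show ?thesis using False by (simp add: shrinkage_def shrink_weight_def)
qed (simp add: shrinkage_def shrink_weight_def)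

lemma URE_eq_weight:
  assumes "\<And>i. i \<in> {1..p} \<Longrightarrow> 0 < tau F i"
  shows "URE F p y g m = (1 / real p) * (\<Sum>i=1..p. (shrink_weight F g i)\<^sup>2 * (y i - m)\<^sup>2
           + (1 - 2 * shrink_weight F g i) * ure_var F i (y i))"
proof (cases "g = \<infinity>")
  case True
  then show ?thesis using URE_infinity[of F p y m] by (simp add: shrink_weight_def ure_var_def)
next
  case False
  have "(enn2real g)\<^sup>2 / (tau F i + enn2real g)\<^sup>2 = (shrink_weight F g i)\<^sup>2 \<and>
      (tau F i - enn2real g) / (tau F i + enn2real g) = 1 - 2 * shrink_weight F g i" if "i \<in> {1..p}" for i
  proof -
    have "tau F i + enn2real g > 0" using assms[OF that] by (simp add: add_pos_nonneg)
    then show ?thesis using False by (simp add: shrink_weight_def power_divide field_simps)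
  qed
  then show ?thesis
    using False by (simp add: URE_def URE_fin_def ure_var_def)
qed

text \<open>
  The trivial weight \<open>1\<close> in the first sum gives all three sums the shape to which the maximal inequality
  applies.
\<close>

lemma URE_minus_loss:
  assumes "\<And>i. i \<in> {1..p} \<Longrightarrow> 0 < tau F i"
  shows "URE F p y g m - loss p (theta F) (shrinkage F y g m) = (1 / real p) *
     ((\<Sum>i=1..p. 1 * (ure_var F i (y i) - (y i - theta F i)\<^sup>2))
      + 2 * (\<Sum>i=1..p. shrink_weight F g i
               * ((y i - theta F i)\<^sup>2 + theta F i * (y i - theta F i) - ure_var F i (y i)))
      - 2 * m * (\<Sum>i=1..p. shrink_weight F g i * (y i - theta F i)))"
proof -
  let ?b = "shrink_weight F g" and ?u = "\<lambda>i. y i - theta F i" and ?w = "\<lambda>i. ure_var F i (y i)"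
  define A where "A = (\<lambda>i. (?b i)\<^sup>2 * (y i - m)\<^sup>2 + (1 - 2 * ?b i) * ?w i)"
  define B where "B = (\<lambda>i. ((1 - ?b i) * y i + ?b i * m - theta F i)\<^sup>2)"
  have "URE F p y g m = (1 / real p) * (\<Sum>i=1..p. A i)"
    unfolding A_def by (rule URE_eq_weight[OF assms])
  moreover have "loss p (theta F) (shrinkage F y g m) = (1 / real p) * (\<Sum>i=1..p. B i)"
    unfolding loss_def B_def using assms by (simp add: shrinkage_eq_weight)
  ultimately have "URE F p y g m - loss p (theta F) (shrinkage F y g m) = (1 / real p) * (\<Sum>i=1..p. A i - B i)"
    by (simp add: sum_subtractf diff_divide_distrib)
  also have "(\<Sum>i=1..p. A i - B i) = (\<Sum>i=1..p. 1 * (?w i - (?u i)\<^sup>2)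
      + 2 * (?b i * ((?u i)\<^sup>2 + theta F i * ?u i - ?w i)) - 2 * m * (?b i * ?u i))"
    by (rule sum.cong) (simp_all add: A_def B_def power2_eq_square algebra_simps)
  finally show ?thesis
    by (simp only: sum_subtractf sum.distrib sum_distrib_left)
qed

lemma max_abs_ge: "i \<in> {1..p} \<Longrightarrow> \<bar>y i\<bar> \<le> max_abs p y"
  by (auto simp: max_abs_def)

lemma max_abs_attained:
  assumes "p \<ge> 1"
  obtains i where "i \<in> {1..p}" "max_abs p y = \<bar>y i\<bar>"
proof -
  have "max_abs p y \<in> (\<lambda>i. \<bar>y i\<bar>) ` {1..p}"
    unfolding max_abs_def using assms by (intro Max_in) auto
  then show thesis using that by auto
qed

lemma square_le_cutoff:
  fixes x r :: real
  assumes "r > 0"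
  shows "x\<^sup>2 \<le> r\<^sup>2 + \<bar>x\<bar> ^ 3 / r"
proof (cases "\<bar>x\<bar> \<le> r")
  case True
  then have "\<bar>x\<bar>\<^sup>2 \<le> r\<^sup>2" by (intro power_mono) auto
  then show ?thesis using assms by (simp add: add_increasing2)
next
  case False
  then have "\<bar>x\<bar>\<^sup>2 * r \<le> \<bar>x\<bar>\<^sup>2 * \<bar>x\<bar>" by (intro mult_left_mono) auto
  also have "\<dots> = \<bar>x\<bar> ^ 3" by (simp add: eval_nat_numeral)
  finally have "x\<^sup>2 \<le> \<bar>x\<bar> ^ 3 / r" using assms by (simp add: field_simps)
  then show ?thesis by (simp add: add_increasing)
qed

text \<open>
  Truncation of the maximum at level \<open>r\<close>: where \<open>\<bar>y\<bar> > r\<close>, the square is at most \<open>\<bar>y\<bar>\<^sup>3 / r\<close>, and the largest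
  cube is at most the sum of all cubes.
\<close>

lemma square_max_abs_le:
  assumes "r > 0" "p \<ge> 1" "\<bar>m\<bar> \<le> max_abs p y"
  shows "m\<^sup>2 \<le> r\<^sup>2 + (\<Sum>i=1..p. \<bar>y i\<bar> ^ 3) / r"
proof -
  obtain i where i: "i \<in> {1..p}" "max_abs p y = \<bar>y i\<bar>" using max_abs_attained[OF assms(2)] .
  have "m\<^sup>2 \<le> (y i)\<^sup>2" using assms(3) i(2) by (simp add: abs_le_square_iff)
  also have "\<dots> \<le> r\<^sup>2 + \<bar>y i\<bar> ^ 3 / r" by (rule square_le_cutoff[OF assms(1)])
  also have "\<bar>y i\<bar> ^ 3 \<le> (\<Sum>i=1..p. \<bar>y i\<bar> ^ 3)"
    using i(1) by (intro member_le_sum) auto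
  finally show ?thesis using assms(1) by (simp add: divide_right_mono)
qed

lemma abs_le_am_gm:
  fixes x a :: real
  assumes "a > 0"
  shows "\<bar>x\<bar> \<le> a + x\<^sup>2 / a"
proof -
  have "0 \<le> (\<bar>x\<bar> - a)\<^sup>2 + a * \<bar>x\<bar>" using assms by simp
  then have "a * \<bar>x\<bar> \<le> a\<^sup>2 + x\<^sup>2" by (simp add: power2_eq_square algebra_simps)
  then show ?thesis using assms by (simp add: field_simps power2_eq_square)
qed

lemma abs_product_le_am_gm:
  fixes m x c :: real
  assumes "c > 0"
  shows "\<bar>2 * m * x\<bar> \<le> c * m\<^sup>2 + x\<^sup>2 / c"
proof -
  have "0 \<le> (c * \<bar>m\<bar> - \<bar>x\<bar>)\<^sup>2" by simp
  then have "c * \<bar>2 * m * x\<bar> \<le> c * (c * m\<^sup>2) + x\<^sup>2"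
    by (simp add: power2_eq_square algebra_simps abs_mult)
  then have "c * \<bar>2 * m * x\<bar> \<le> c * (c * m\<^sup>2 + x\<^sup>2 / c)" using assms by (simp add: algebra_simps)
  then show ?thesis using assms by simp
qed

lemma integrable_of_nonneg_le:
  fixes f g :: "'a \<Rightarrow> real"
  assumes "integrable M g" "f \<in> borel_measurable M" "\<And>x. 0 \<le> f x" "\<And>x. f x \<le> g x"
  shows "integrable M f"
  by (rule Bochner_Integration.integrable_bound[OF assms(1,2)])
    (use assms(3,4) in \<open>auto intro!: AE_I2 order_trans[OF assms(4) abs_ge_self]\<close>)

lemma square_add3_le:
  fixes x y z :: real
  shows "(x + y + z)\<^sup>2 \<le> 3 * (x\<^sup>2 + y\<^sup>2 + z\<^sup>2)"
proof -
  have "0 \<le> (x - y)\<^sup>2 + (y - z)\<^sup>2 + (x - z)\<^sup>2" by simp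
  then show ?thesis by (simp add: power2_eq_square algebra_simps)
qed

lemma Vfun_expand:
  "Vfun F y = Vfun F \<theta> + (nu1 F + 2 * nu2 F * \<theta>) * (y - \<theta>) + nu2 F * (y - \<theta>)\<^sup>2"
  by (simp add: Vfun_def power2_eq_square algebra_simps)

lemma Vfun_measurable [measurable]: "Vfun F \<in> borel_measurable borel"
  unfolding Vfun_def by measurable

lemma ure_var_measurable [measurable]: "ure_var F i \<in> borel_measurable borel"
  unfolding ure_var_def by measurable

text \<open>
  What the five families and their conditions provide: an independent sample with the moments of a
  quadratic variance function, dominated by numbers \<open>e i\<close> whose partial sums grow at most linearly.
\<close>

locale qvf_sample = prob_space M for M :: "'a measure" +
  fixes F :: nef_qvf and Y :: "nat \<Rightarrow> 'a \<Rightarrow> real" and e :: "nat \<Rightarrow> real" and C :: real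
  assumes tau_pos: "i \<ge> 1 \<Longrightarrow> 0 < tau F i"
    and tau_nu2_pos: "i \<ge> 1 \<Longrightarrow> 0 < tau F i + nu2 F"
    and indep: "indep_vars (\<lambda>_. borel) Y {1..}"
    and mean: "i \<ge> 1 \<Longrightarrow> has_bochner_integral M (\<lambda>\<omega>. Y i \<omega> - theta F i) 0"
    and var: "i \<ge> 1 \<Longrightarrow> has_bochner_integral M (\<lambda>\<omega>. (Y i \<omega> - theta F i)\<^sup>2) (Vfun F (theta F i) / tau F i)"
    and fourth: "i \<ge> 1 \<Longrightarrow> has_bochner_integral M (\<lambda>\<omega>. (Y i \<omega> - theta F i) ^ 4) (fourth_moment F i)"
    and envelope: "i \<ge> 1 \<Longrightarrow> moment_envelope F i (e i)"
    and growth: "\<forall>\<^sub>F p in sequentially. (\<Sum>i=1..p. e i) \<le> C * real p"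
begin

lemma Y_measurable [measurable]: "i \<ge> 1 \<Longrightarrow> Y i \<in> borel_measurable M"
  using indep by (auto simp: indep_vars_def)

text \<open>
  Expanding \<open>V\<close> around the mean, \<open>V(Y)\<close> has expectation \<open>V(\<theta>) + \<nu>\<^sub>2 V(\<theta>) / \<tau> = (\<tau> + \<nu>\<^sub>2) V(\<theta>) / \<tau>\<close>; this
  is the reason for the denominator \<open>\<tau> + \<nu>\<^sub>2\<close>.
\<close>

lemma ure_var_unbiased:
  assumes "i \<ge> 1"
  shows "has_bochner_integral M (\<lambda>\<omega>. ure_var F i (Y i \<omega>)) (Vfun F (theta F i) / tau F i)"
proof -
  define v where "v = Vfun F (theta F i)"
  define d where "d = nu1 F + 2 * nu2 F * theta F i"
  have "has_bochner_integral M (\<lambda>\<omega>. (v + d * (Y i \<omega> - theta F i) + nu2 F * (Y i \<omega> - theta F i)\<^sup>2) / (tau F i + nu2 F))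
      ((v + d * 0 + nu2 F * (v / tau F i)) / (tau F i + nu2 F))"
    using mean[OF assms] var[OF assms, folded v_def] prob_space
    by (intro has_bochner_integral_divide_zero has_bochner_integral_add has_bochner_integral_mult_right)
      (auto simp: has_bochner_integral_iff)
  also have "(v + d * 0 + nu2 F * (v / tau F i)) / (tau F i + nu2 F) = v / tau F i"
  proof -
    have "v + nu2 F * (v / tau F i) = v / tau F i * (tau F i + nu2 F)"
      using tau_pos[OF assms] by (simp add: field_simps)
    then show ?thesis using tau_nu2_pos[OF assms] by simp
  qed
  finally show ?thesis
    by (simp add: ure_var_def v_def d_def flip: Vfun_expand)
qed

lemma ure_var_square:
  assumes "i \<ge> 1"
  shows "integrable M (\<lambda>\<omega>. (ure_var F i (Y i \<omega>))\<^sup>2)" and "expectation (\<lambda>\<omega>. (ure_var F i (Y i \<omega>))\<^sup>2) \<le> e i"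
proof -
  define v where "v = Vfun F (theta F i)"
  define d where "d = nu1 F + 2 * nu2 F * theta F i"
  define w where "w = tau F i + nu2 F"
  let ?u = "\<lambda>\<omega>. Y i \<omega> - theta F i"
  let ?B = "\<lambda>\<omega>. 3 * (v\<^sup>2 + d\<^sup>2 * (?u \<omega>)\<^sup>2 + (nu2 F)\<^sup>2 * ?u \<omega> ^ 4) / w\<^sup>2"
  have le: "(ure_var F i (Y i \<omega>))\<^sup>2 \<le> ?B \<omega>" for \<omega>
  proof -
    have "(Vfun F (Y i \<omega>))\<^sup>2 \<le> 3 * (v\<^sup>2 + d\<^sup>2 * (?u \<omega>)\<^sup>2 + (nu2 F)\<^sup>2 * ?u \<omega> ^ 4)"
      using square_add3_le[of v "d * ?u \<omega>" "nu2 F * (?u \<omega>)\<^sup>2"]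
      by (simp add: Vfun_expand[of F "Y i \<omega>" "theta F i"] v_def d_def power_mult_distrib flip: power_mult)
    then show ?thesis by (simp add: ure_var_def w_def power_divide divide_right_mono)
  qed
  have B: "has_bochner_integral M ?B (ure_var_bound F i)"
    unfolding ure_var_bound_def v_def[symmetric] d_def[symmetric] w_def[symmetric]
    using fourth[OF assms] var[OF assms, folded v_def] prob_space
    by (intro has_bochner_integral_divide_zero has_bochner_integral_add has_bochner_integral_mult_right)
      (auto simp: has_bochner_integral_iff)
  show int: "integrable M (\<lambda>\<omega>. (ure_var F i (Y i \<omega>))\<^sup>2)"
    by (rule integrable_of_nonneg_le[of M ?B]) (use B le assms in \<open>auto simp: has_bochner_integral_iff\<close>)
  have "expectation (\<lambda>\<omega>. (ure_var F i (Y i \<omega>))\<^sup>2) \<le> expectation ?B"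
    by (rule integral_mono) (use B int le in \<open>auto simp: has_bochner_integral_iff\<close>)
  also have "\<dots> \<le> e i"
    using B envelope[OF assms] by (simp add: has_bochner_integral_iff moment_envelope_def)
  finally show "expectation (\<lambda>\<omega>. (ure_var F i (Y i \<omega>))\<^sup>2) \<le> e i" .
qed

text \<open>
  The three kinds of summands in the gap are the cases \<open>a = -1, h = 0\<close>, \<open>a = 1, h = \<theta>\<close> and \<open>a = 0, h = 1\<close>.
  They are centred because the estimated variance is unbiased. The bound is \<open>3 (1 + 2 + 1) e i\<close>, from
  \<open>(x + y + z)\<^sup>2 \<le> 3 (x\<^sup>2 + y\<^sup>2 + z\<^sup>2)\<close>; the factor \<open>2\<close> in the condition on \<open>h\<close> leaves room for \<open>h = 1\<close>.
\<close>

lemma centred_terms_orthogonal: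
  fixes a :: real and h :: "nat \<Rightarrow> real"
  assumes "\<bar>a\<bar> \<le> 1" and h: "\<And>i. i \<ge> 1 \<Longrightarrow> (h i)\<^sup>2 * (Vfun F (theta F i) / tau F i) \<le> 2 * e i"
  defines "f \<equiv> \<lambda>i y. a * (y - theta F i)\<^sup>2 + h i * (y - theta F i) + (- a) * ure_var F i y"
  shows "orthogonal_on {1..p} (\<lambda>i \<omega>. f i (Y i \<omega>))"
    and "i \<ge> 1 \<Longrightarrow> expectation (\<lambda>\<omega>. (f i (Y i \<omega>))\<^sup>2) \<le> 12 * e i"
proof -
  let ?u = "\<lambda>i \<omega>. Y i \<omega> - theta F i"
  have zero: "has_bochner_integral M (\<lambda>\<omega>. f i (Y i \<omega>)) 0" if "i \<ge> 1" for i
  proof -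
    have "has_bochner_integral M (\<lambda>\<omega>. f i (Y i \<omega>))
        (a * (Vfun F (theta F i) / tau F i) + h i * 0 + (- a) * (Vfun F (theta F i) / tau F i))"
      unfolding f_def
      by (intro has_bochner_integral_add has_bochner_integral_mult_right mean var ure_var_unbiased that)
    then show ?thesis by simp
  qed
  have [measurable]: "f i \<in> borel_measurable borel" for i
    unfolding f_def by measurable
  let ?B = "\<lambda>i \<omega>. 3 * (?u i \<omega> ^ 4 + (h i)\<^sup>2 * (?u i \<omega>)\<^sup>2 + (ure_var F i (Y i \<omega>))\<^sup>2)"
  have le: "(f i (Y i \<omega>))\<^sup>2 \<le> ?B i \<omega>" for i \<omega>
  proof -
    have a: "a\<^sup>2 \<le> 1" using assms(1) abs_square_le_1 by auto
    have "(f i (Y i \<omega>))\<^sup>2 \<le> 3 * ((a * (?u i \<omega>)\<^sup>2)\<^sup>2 + (h i * ?u i \<omega>)\<^sup>2 + (- a * ure_var F i (Y i \<omega>))\<^sup>2)"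
      unfolding f_def by (rule square_add3_le)
    also have "\<dots> = 3 * (a\<^sup>2 * ?u i \<omega> ^ 4 + (h i)\<^sup>2 * (?u i \<omega>)\<^sup>2 + a\<^sup>2 * (ure_var F i (Y i \<omega>))\<^sup>2)"
      by (simp add: power_mult_distrib flip: power_mult)
    also have "\<dots> \<le> ?B i \<omega>"
      using a by (intro mult_left_mono add_mono order_refl mult_left_le_one_le) auto
    finally show ?thesis .
  qed
  have B: "has_bochner_integral M (?B i) (3 * (fourth_moment F i + (h i)\<^sup>2 * (Vfun F (theta F i) / tau F i)
      + expectation (\<lambda>\<omega>. (ure_var F i (Y i \<omega>))\<^sup>2)))" if "i \<ge> 1" for i
    by (intro has_bochner_integral_add has_bochner_integral_mult_right fourth var
        has_bochner_integral_integrable ure_var_square that)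
  have int: "integrable M (\<lambda>\<omega>. (f i (Y i \<omega>))\<^sup>2)" if "i \<ge> 1" for i
  proof (rule integrable_of_nonneg_le[OF _ _ _ le])
    show "integrable M (?B i)" using B[OF that] by (simp only: has_bochner_integral_iff)
  qed (use that in auto)
  show "orthogonal_on {1..p} (\<lambda>i \<omega>. f i (Y i \<omega>))"
    by (rule orthogonal_on_indep_centred) (use indep_vars_subset[OF indep] zero int in auto)
  show "expectation (\<lambda>\<omega>. (f i (Y i \<omega>))\<^sup>2) \<le> 12 * e i" if "i \<ge> 1"
  proof -
    have "expectation (\<lambda>\<omega>. (f i (Y i \<omega>))\<^sup>2) \<le> expectation (?B i)"
      by (rule integral_mono[OF int[OF that] _ le]) (use B[OF that] in \<open>simp only: has_bochner_integral_iff\<close>)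
    also have "\<dots> = 3 * (fourth_moment F i + (h i)\<^sup>2 * (Vfun F (theta F i) / tau F i)
      + expectation (\<lambda>\<omega>. (ure_var F i (Y i \<omega>))\<^sup>2))"
      using B[OF that] by (simp only: has_bochner_integral_iff)
    also have "\<dots> \<le> 3 * (e i + 2 * e i + e i)"
      using h[OF that] envelope[OF that] ure_var_square(2)[OF that]
      by (intro mult_left_mono add_mono) (auto simp: moment_envelope_def)
    finally show ?thesis by simp
  qed
qed

text \<open>
  From \<open>u\<^sup>2 \<le> 1 + u\<^sup>4\<close>.
\<close>

lemma variance_le_envelope:
  assumes "i \<ge> 1"
  shows "Vfun F (theta F i) / tau F i \<le> 2 * e i"
proof -
  let ?u = "\<lambda>\<omega>. Y i \<omega> - theta F i"
  have "expectation (\<lambda>\<omega>. (?u \<omega>)\<^sup>2) \<le> expectation (\<lambda>\<omega>. 1 + ?u \<omega> ^ 4)"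
  proof (rule integral_mono)
    fix \<omega>
    show "(?u \<omega>)\<^sup>2 \<le> 1 + ?u \<omega> ^ 4"
      using abs_le_am_gm[of 1 "(?u \<omega>)\<^sup>2"] by simp
  qed (use var[OF assms] fourth[OF assms] in \<open>auto simp: has_bochner_integral_iff\<close>)
  then show ?thesis
    using var[OF assms] fourth[OF assms] envelope[OF assms] prob_space
    by (simp add: has_bochner_integral_iff moment_envelope_def)
qed

lemma third_moment:
  assumes "i \<ge> 1"
  shows "integrable M (\<lambda>\<omega>. \<bar>Y i \<omega>\<bar> ^ 3)" and "expectation (\<lambda>\<omega>. \<bar>Y i \<omega>\<bar> ^ 3) \<le> 12 * e i"
proof -
  let ?B = "\<lambda>\<omega>. 4 * (\<bar>theta F i\<bar> ^ 3 + (1 + (Y i \<omega> - theta F i) ^ 4))"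
  have le: "\<bar>Y i \<omega>\<bar> ^ 3 \<le> ?B \<omega>" for \<omega>
  proof -
    define u where "u = \<bar>Y i \<omega> - theta F i\<bar>"
    have u: "u \<ge> 0" "u ^ 4 = (Y i \<omega> - theta F i) ^ 4" by (simp_all add: u_def)
    have "u ^ 3 \<le> 1 + u ^ 4"
    proof (cases "u \<le> 1")
      case True
      then have "u ^ 3 \<le> 1" using u by (intro power_le_one) auto
      then show ?thesis using u by (simp add: add_increasing2)
    next
      case False
      then have "u ^ 3 \<le> u ^ 4" by (intro power_increasing) auto
      then show ?thesis by simp
    qed
    have "\<bar>Y i \<omega>\<bar> ^ 3 \<le> (\<bar>theta F i\<bar> + u) ^ 3" by (intro power_mono) (auto simp: u_def)
    also have "\<dots> \<le> 4 * (\<bar>theta F i\<bar> ^ 3 + u ^ 3)"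
      by (rule cube_add_le) (simp_all add: u)
    also have "\<dots> \<le> 4 * (\<bar>theta F i\<bar> ^ 3 + (1 + u ^ 4))"
      using \<open>u ^ 3 \<le> 1 + u ^ 4\<close> by simp
    finally show ?thesis unfolding u(2) .
  qed
  have B: "has_bochner_integral M ?B (4 * (\<bar>theta F i\<bar> ^ 3 + (1 + fourth_moment F i)))"
    using fourth[OF assms] prob_space
    by (intro has_bochner_integral_add has_bochner_integral_mult_right) (auto simp: has_bochner_integral_iff)
  show int: "integrable M (\<lambda>\<omega>. \<bar>Y i \<omega>\<bar> ^ 3)"
  proof (rule integrable_of_nonneg_le[OF _ _ _ le])
    show "integrable M ?B" using B by (simp only: has_bochner_integral_iff)
  qed (use assms in auto)
  have "expectation (\<lambda>\<omega>. \<bar>Y i \<omega>\<bar> ^ 3) \<le> expectation ?B"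
    by (rule integral_mono[OF int _ le]) (use B in \<open>simp only: has_bochner_integral_iff\<close>)
  also have "\<dots> = 4 * (\<bar>theta F i\<bar> ^ 3 + (1 + fourth_moment F i))"
    using B by (simp only: has_bochner_integral_iff)
  also have "\<dots> \<le> 12 * e i"
    using envelope[OF assms] by (simp add: moment_envelope_def)
  finally show "expectation (\<lambda>\<omega>. \<bar>Y i \<omega>\<bar> ^ 3) \<le> 12 * e i" .
qed

text \<open>
  Dominating variable for the gap, uniformly in \<open>g\<close> and \<open>m\<close>, at a fixed sample size. The parameters balance the
  contributions: \<open>a\<close> splits \<open>\<bar>x\<bar> \<le> a + x\<^sup>2 / a\<close> in the first two sums, \<open>c\<close> splits the product of \<open>m\<close> with the
  third sum, and \<open>r\<close> is the truncation level for the largest observation.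
\<close>

lemma gap_bound:
  fixes a c r :: real
  assumes "p \<ge> 1" "p < 2 ^ n" and pos: "a > 0" "c > 0" "r > 0"
  obtains D where "integrable M D"
    and "expectation D \<le> (1 / real p) * (3 * a + 36 * (real n)\<^sup>2 * (\<Sum>i=1..p. e i) / a
           + c * (r\<^sup>2 + 12 * (\<Sum>i=1..p. e i) / r) + 12 * (real n)\<^sup>2 * (\<Sum>i=1..p. e i) / c)"
    and "\<And>\<omega> g m. \<bar>m\<bar> \<le> max_abs p (\<lambda>i. Y i \<omega>) \<Longrightarrow>
           \<bar>URE F p (\<lambda>i. Y i \<omega>) g m - loss p (theta F) (shrinkage F (\<lambda>i. Y i \<omega>) g m)\<bar> \<le> D \<omega>"
proof -
  define E where "E = (\<Sum>i=1..p. e i)"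
  define f where "f = (\<lambda>(x::real) h i y. x * (y - theta F i)\<^sup>2 + h i * (y - theta F i) + (- x) * ure_var F i y)"
  have maximal: "\<exists>Q. integrable M Q \<and> expectation Q \<le> 12 * (real n)\<^sup>2 * E \<and>
      (\<forall>\<omega> b. (\<forall>i\<in>{1..p}. 0 \<le> b i \<and> b i \<le> 1) \<longrightarrow>
        (\<forall>i\<in>{1..p}. \<forall>j\<in>{1..p}. tau F i \<le> tau F j \<longrightarrow> b j \<le> b i) \<longrightarrow>
        (\<Sum>i=1..p. b i * f x h i (Y i \<omega>))\<^sup>2 \<le> Q \<omega>)"
    if xh: "\<bar>x\<bar> \<le> 1" "\<And>i. i \<ge> 1 \<Longrightarrow> (h i)\<^sup>2 * (Vfun F (theta F i) / tau F i) \<le> 2 * e i" for x h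
  proof -
    have orth: "orthogonal_on {1..p} (\<lambda>i \<omega>. f x h i (Y i \<omega>))"
      and le: "\<And>i. i \<ge> 1 \<Longrightarrow> expectation (\<lambda>\<omega>. (f x h i (Y i \<omega>))\<^sup>2) \<le> 12 * e i"
      unfolding f_def by (rule centred_terms_orthogonal[OF xh]; assumption)+
    obtain Q where Q: "integrable M Q"
      "expectation Q \<le> (real n)\<^sup>2 * (\<Sum>i=1..p. expectation (\<lambda>\<omega>. (f x h i (Y i \<omega>))\<^sup>2))"
      "\<And>\<omega> b. (\<And>i. i \<in> {1..p} \<Longrightarrow> 0 \<le> b i \<and> b i \<le> 1) \<Longrightarrow>
           (\<And>i j. i \<in> {1..p} \<Longrightarrow> j \<in> {1..p} \<Longrightarrow> tau F i \<le> tau F j \<Longrightarrow> b j \<le> b i) \<Longrightarrow>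
           (\<Sum>i=1..p. b i * f x h i (Y i \<omega>))\<^sup>2 \<le> Q \<omega>"
      by (rule monotone_weights_maximal[OF orth assms(2), where t = "tau F"]) blast
    have "(\<Sum>i=1..p. expectation (\<lambda>\<omega>. (f x h i (Y i \<omega>))\<^sup>2)) \<le> (\<Sum>i=1..p. 12 * e i)"
      by (intro sum_mono le) auto
    also have "\<dots> = 12 * E" by (simp add: E_def sum_distrib_left)
    finally have "expectation Q \<le> (real n)\<^sup>2 * (12 * E)"
      using order_trans[OF Q(2) mult_left_mono] by simp
    with Q(1,3) show ?thesis
      by (intro exI[of _ Q] conjI allI impI) (auto simp: algebra_simps)
  qed
  have th: "(theta F i)\<^sup>2 * (Vfun F (theta F i) / tau F i) \<le> 2 * e i" if "i \<ge> 1" for i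
    using envelope[OF that] by (simp add: moment_envelope_def)
  have e0: "(0::real)\<^sup>2 * (Vfun F (theta F i) / tau F i) \<le> 2 * e i" if "i \<ge> 1" for i
    using envelope[OF that] by (simp add: moment_envelope_def)
  obtain Q1 where Q1: "integrable M Q1" "expectation Q1 \<le> 12 * (real n)\<^sup>2 * E"
      "\<And>\<omega> b. (\<forall>i\<in>{1..p}. 0 \<le> b i \<and> b i \<le> 1) \<Longrightarrow>
        (\<forall>i\<in>{1..p}. \<forall>j\<in>{1..p}. tau F i \<le> tau F j \<longrightarrow> b j \<le> b i) \<Longrightarrow>
        (\<Sum>i=1..p. b i * f (-1) (\<lambda>_. 0) i (Y i \<omega>))\<^sup>2 \<le> Q1 \<omega>"
    using maximal[of "-1" "\<lambda>_. 0", OF _ e0] by auto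
  obtain Q2 where Q2: "integrable M Q2" "expectation Q2 \<le> 12 * (real n)\<^sup>2 * E"
      "\<And>\<omega> b. (\<forall>i\<in>{1..p}. 0 \<le> b i \<and> b i \<le> 1) \<Longrightarrow>
        (\<forall>i\<in>{1..p}. \<forall>j\<in>{1..p}. tau F i \<le> tau F j \<longrightarrow> b j \<le> b i) \<Longrightarrow>
        (\<Sum>i=1..p. b i * f 1 (theta F) i (Y i \<omega>))\<^sup>2 \<le> Q2 \<omega>"
    using maximal[of 1 "theta F", OF _ th] by auto
  obtain Q3 where Q3: "integrable M Q3" "expectation Q3 \<le> 12 * (real n)\<^sup>2 * E"
      "\<And>\<omega> b. (\<forall>i\<in>{1..p}. 0 \<le> b i \<and> b i \<le> 1) \<Longrightarrow>
        (\<forall>i\<in>{1..p}. \<forall>j\<in>{1..p}. tau F i \<le> tau F j \<longrightarrow> b j \<le> b i) \<Longrightarrow>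
        (\<Sum>i=1..p. b i * f 0 (\<lambda>_. 1) i (Y i \<omega>))\<^sup>2 \<le> Q3 \<omega>"
    using maximal[of 0 "\<lambda>_. 1"] variance_le_envelope by auto
  define T where "T = (\<lambda>\<omega>. \<Sum>i=1..p. \<bar>Y i \<omega>\<bar> ^ 3)"
  have T: "integrable M T" "expectation T \<le> 12 * E"
  proof -
    show "integrable M T" unfolding T_def using third_moment(1) by auto
    have "expectation T = (\<Sum>i=1..p. expectation (\<lambda>\<omega>. \<bar>Y i \<omega>\<bar> ^ 3))"
      unfolding T_def using third_moment(1) by (intro Bochner_Integration.integral_sum) auto
    also have "\<dots> \<le> (\<Sum>i=1..p. 12 * e i)" by (intro sum_mono third_moment(2)) auto
    finally show "expectation T \<le> 12 * E" by (simp add: E_def sum_distrib_left)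
  qed
  define D where "D = (\<lambda>\<omega>. (1 / real p) *
      ((a + Q1 \<omega> / a) + 2 * (a + Q2 \<omega> / a) + (c * (r\<^sup>2 + T \<omega> / r) + Q3 \<omega> / c)))"
  show thesis
  proof (rule that)
    show "integrable M D" unfolding D_def using Q1(1) Q2(1) Q3(1) T(1) by simp
    have "expectation D = (1 / real p) * ((a + expectation Q1 / a) + 2 * (a + expectation Q2 / a)
        + (c * (r\<^sup>2 + expectation T / r) + expectation Q3 / c))"
      unfolding D_def using Q1(1) Q2(1) Q3(1) T(1) prob_space by simp
    also have "\<dots> \<le> (1 / real p) * ((a + 12 * (real n)\<^sup>2 * E / a) + 2 * (a + 12 * (real n)\<^sup>2 * E / a)
        + (c * (r\<^sup>2 + 12 * E / r) + 12 * (real n)\<^sup>2 * E / c))"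
      using Q1(2) Q2(2) Q3(2) T(2) pos
      by (intro mult_left_mono add_mono divide_right_mono order_refl) auto
    also have "\<dots> = (1 / real p) * (3 * a + 36 * (real n)\<^sup>2 * E / a
        + c * (r\<^sup>2 + 12 * E / r) + 12 * (real n)\<^sup>2 * E / c)"
      by (simp add: add_divide_distrib)
    finally show "expectation D \<le> (1 / real p) * (3 * a + 36 * (real n)\<^sup>2 * (\<Sum>i=1..p. e i) / a
        + c * (r\<^sup>2 + 12 * (\<Sum>i=1..p. e i) / r) + 12 * (real n)\<^sup>2 * (\<Sum>i=1..p. e i) / c)"
      unfolding E_def .
  next
    fix \<omega> g m
    assume m: "\<bar>m\<bar> \<le> max_abs p (\<lambda>i. Y i \<omega>)"
    let ?b = "shrink_weight F g"
    define S1 where "S1 = (\<Sum>i=1..p. 1 * f (-1) (\<lambda>_. 0) i (Y i \<omega>))"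
    define S2 where "S2 = (\<Sum>i=1..p. ?b i * f 1 (theta F) i (Y i \<omega>))"
    define S3 where "S3 = (\<Sum>i=1..p. ?b i * f 0 (\<lambda>_. 1) i (Y i \<omega>))"
    have b: "\<forall>i\<in>{1..p}. 0 \<le> ?b i \<and> ?b i \<le> 1"
      "\<forall>i\<in>{1..p}. \<forall>j\<in>{1..p}. tau F i \<le> tau F j \<longrightarrow> ?b j \<le> ?b i"
      using shrink_weight_bounds shrink_weight_antimono tau_pos by auto
    have "S1\<^sup>2 \<le> Q1 \<omega>" unfolding S1_def by (rule Q1(3)) auto
    then have 1: "\<bar>S1\<bar> \<le> a + Q1 \<omega> / a"
      using abs_le_am_gm[OF pos(1), of S1] divide_right_mono[of "S1\<^sup>2" "Q1 \<omega>" a] pos by simp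
    have "S2\<^sup>2 \<le> Q2 \<omega>" unfolding S2_def by (rule Q2(3)[OF b])
    then have 2: "\<bar>S2\<bar> \<le> a + Q2 \<omega> / a"
      using abs_le_am_gm[OF pos(1), of S2] divide_right_mono[of "S2\<^sup>2" "Q2 \<omega>" a] pos by simp
    have "S3\<^sup>2 \<le> Q3 \<omega>" unfolding S3_def by (rule Q3(3)[OF b])
    moreover have "c * m\<^sup>2 \<le> c * (r\<^sup>2 + T \<omega> / r)"
      unfolding T_def using square_max_abs_le[OF pos(3) assms(1) m] pos by (intro mult_left_mono) auto
    ultimately have 3: "\<bar>2 * m * S3\<bar> \<le> c * (r\<^sup>2 + T \<omega> / r) + Q3 \<omega> / c"
      using abs_product_le_am_gm[OF pos(2), of m S3] divide_right_mono[of "S3\<^sup>2" "Q3 \<omega>" c] pos by linarith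
    have "URE F p (\<lambda>i. Y i \<omega>) g m - loss p (theta F) (shrinkage F (\<lambda>i. Y i \<omega>) g m)
        = (1 / real p) * (S1 + 2 * S2 - 2 * m * S3)"
      unfolding S1_def S2_def S3_def f_def
      by (subst URE_minus_loss) (use tau_pos in \<open>simp_all add: add.commute\<close>)
    also have "\<bar>\<dots>\<bar> = (1 / real p) * \<bar>S1 + 2 * S2 - 2 * m * S3\<bar>"
      by (simp add: abs_mult)
    also have "\<dots> \<le> D \<omega>"
      unfolding D_def using 1 2 3 by (intro mult_left_mono) auto
    finally show "\<bar>URE F p (\<lambda>i. Y i \<omega>) g m - loss p (theta F) (shrinkage F (\<lambda>i. Y i \<omega>) g m)\<bar> \<le> D \<omega>" .
  qed
qed

end

text \<open>
  The choice \<open>a = p powr (3/4)\<close>, \<open>c = p powr (1/6)\<close>, \<open>r = p powr (1/3)\<close> in the previous bound. The exponent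
  of \<open>r\<close> balances the two terms of the truncation, both of order \<open>p powr (2/3)\<close>; \<open>c\<close> may be any power with
  exponent strictly between \<open>0\<close> and \<open>1/3\<close>, and \<open>a\<close> any power with exponent strictly between \<open>0\<close> and \<open>1\<close>.
\<close>

lemma gap_bound_vanishes:
  "(\<lambda>p. (1 / real p) * (3 * (real p powr (3/4)) + 36 * (log 2 (real p) + 1)\<^sup>2 * (K * real p) / (real p powr (3/4))
      + (real p powr (1/6)) * ((real p powr (1/3))\<^sup>2 + 12 * (K * real p) / (real p powr (1/3)))
      + 12 * (log 2 (real p) + 1)\<^sup>2 * (K * real p) / (real p powr (1/6)))) \<longlonglongrightarrow> 0"
proof -
  let ?L = "\<lambda>p. log 2 (real p) + 1"
  have "(\<lambda>p. (1 / real p) * (3 * (real p powr (3/4)) + (real p powr (1/6)) * (real p powr (1/3))\<^sup>2)) \<longlonglongrightarrow> 0"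
    by real_asymp
  moreover have "(\<lambda>p. (1 / real p) * (36 * (?L p)\<^sup>2 * real p / (real p powr (3/4))
      + (real p powr (1/6)) * (12 * real p / (real p powr (1/3)))
      + 12 * (?L p)\<^sup>2 * real p / (real p powr (1/6)))) \<longlonglongrightarrow> 0"
    by real_asymp
  ultimately have "(\<lambda>p. (1 / real p) * (3 * (real p powr (3/4)) + (real p powr (1/6)) * (real p powr (1/3))\<^sup>2)
      + K * ((1 / real p) * (36 * (?L p)\<^sup>2 * real p / (real p powr (3/4))
      + (real p powr (1/6)) * (12 * real p / (real p powr (1/3)))
      + 12 * (?L p)\<^sup>2 * real p / (real p powr (1/6))))) \<longlonglongrightarrow> 0 + K * 0"
    by (intro tendsto_add tendsto_mult_left)
  moreover have "(1 / P) * (3 * A + B * R) + K * ((1 / P) * (36 * L * P / A + B * (12 * P / r) + 12 * L * P / B))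
      = (1 / P) * (3 * A + 36 * L * (K * P) / A + B * (R + 12 * (K * P) / r) + 12 * L * (K * P) / B)"
    for A B R r L P :: real
    by (simp only: divide_inverse distrib_left distrib_right mult_ac add_ac)
  ultimately show ?thesis by (simp only: mult_zero_right add_0_right)
qed


context qvf_sample
begin

text \<open>
  The dominating variables of the previous bound along the sample sizes; their expectations vanish because the
  envelope grows at most linearly and the exponent \<open>n\<close> is at most \<open>log 2 p + 1\<close>.
\<close>

lemma uniform_gap:
  obtains D where "\<And>p. p \<ge> 1 \<Longrightarrow> integrable M (D p)"
    and "(\<lambda>p. expectation (D p)) \<longlonglongrightarrow> 0"
    and "\<And>p \<omega> g m. p \<ge> 1 \<Longrightarrow> \<bar>m\<bar> \<le> max_abs p (\<lambda>i. Y i \<omega>) \<Longrightarrow>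
           \<bar>URE F p (\<lambda>i. Y i \<omega>) g m - loss p (theta F) (shrinkage F (\<lambda>i. Y i \<omega>) g m)\<bar> \<le> D p \<omega>"
proof -
  \<comment> \<open>The least exponent with \<open>p < 2 ^ n\<close>.\<close>
  define n where "n = (\<lambda>p::nat. Suc (floor_log p))"
  define a c r where "a = (\<lambda>p. real p powr (3/4))" and "c = (\<lambda>p. real p powr (1/6))" and "r = (\<lambda>p. real p powr (1/3))"
  define E where "E = (\<lambda>p. \<Sum>i=1..p. e i)"
  define R where "R = (\<lambda>p x y. (1 / real p) * (3 * a p + 36 * x\<^sup>2 * y / a p
      + c p * ((r p)\<^sup>2 + 12 * y / r p) + 12 * x\<^sup>2 * y / c p))"
  define gap where "gap = (\<lambda>p \<omega> g m. \<bar>URE F p (\<lambda>i. Y i \<omega>) g m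
      - loss p (theta F) (shrinkage F (\<lambda>i. Y i \<omega>) g m)\<bar>)"
  have "\<exists>D. p \<ge> 1 \<longrightarrow> integrable M D \<and> expectation D \<le> R p (real (n p)) (E p) \<and>
      (\<forall>\<omega> g m. \<bar>m\<bar> \<le> max_abs p (\<lambda>i. Y i \<omega>) \<longrightarrow> gap p \<omega> g m \<le> D \<omega>)" for p
  proof (cases "p \<ge> 1")
    case True
    have "p < 2 ^ n p" using floor_log_exp2_gt[of p] by (simp add: n_def)
    moreover have "a p > 0" "c p > 0" "r p > 0" using True by (auto simp: a_def c_def r_def)
    ultimately show ?thesis
    proof (rule gap_bound[OF True])
      fix D
      assume "integrable M D" "expectation D \<le> (1 / real p) * (3 * a p + 36 * (real (n p))\<^sup>2 * (\<Sum>i=1..p. e i) / a p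
           + c p * ((r p)\<^sup>2 + 12 * (\<Sum>i=1..p. e i) / r p) + 12 * (real (n p))\<^sup>2 * (\<Sum>i=1..p. e i) / c p)"
        "\<And>\<omega> g m. \<bar>m\<bar> \<le> max_abs p (\<lambda>i. Y i \<omega>) \<Longrightarrow>
           \<bar>URE F p (\<lambda>i. Y i \<omega>) g m - loss p (theta F) (shrinkage F (\<lambda>i. Y i \<omega>) g m)\<bar> \<le> D \<omega>"
      then show ?thesis unfolding R_def E_def gap_def by blast
    qed
  qed simp
  from choice[OF allI, OF this] obtain D where
    D_all: "\<forall>p. p \<ge> 1 \<longrightarrow> integrable M (D p) \<and> expectation (D p) \<le> R p (real (n p)) (E p) \<and>
      (\<forall>\<omega> g m. \<bar>m\<bar> \<le> max_abs p (\<lambda>i. Y i \<omega>) \<longrightarrow> gap p \<omega> g m \<le> D p \<omega>)" ..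
  then have D: "\<And>p. p \<ge> 1 \<Longrightarrow> integrable M (D p)"
    "\<And>p. p \<ge> 1 \<Longrightarrow> expectation (D p) \<le> R p (real (n p)) (E p)"
    "\<And>p \<omega> g m. p \<ge> 1 \<Longrightarrow> \<bar>m\<bar> \<le> max_abs p (\<lambda>i. Y i \<omega>) \<Longrightarrow> gap p \<omega> g m \<le> D p \<omega>"
    by simp_all
  have nonneg: "0 \<le> expectation (D p)" if "p \<ge> 1" for p
  proof (rule integral_nonneg_AE, rule AE_I2)
    fix \<omega>
    have "\<bar>0\<bar> \<le> max_abs p (\<lambda>i. Y i \<omega>)"
      using max_abs_ge[of 1 p "\<lambda>i. Y i \<omega>"] that by simp
    from D(3)[OF that this, of 0] show "0 \<le> D p \<omega>" unfolding gap_def by linarith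
  qed
  have mono: "R p x y \<le> R p x' y'" if "p \<ge> 1" "0 \<le> x" "x \<le> x'" "0 \<le> y" "y \<le> y'" for p x x' y y'
    unfolding R_def a_def c_def r_def using that
    by (intro mult_left_mono add_mono divide_right_mono order_refl mult_mono power_mono) auto
  have upper: "\<forall>\<^sub>F p in sequentially. expectation (D p) \<le> R p (log 2 (real p) + 1) (C * real p)"
    using growth eventually_ge_at_top[of 1]
  proof eventually_elim
    case (elim p)
    have "real (floor_log p) \<le> log 2 (real p)"
      using elim(2) by (simp add: floor_log_altdef of_nat_floor)
    moreover have "0 \<le> E p" unfolding E_def
      using envelope by (intro sum_nonneg) (force simp: moment_envelope_def)
    ultimately have "R p (real (n p)) (E p) \<le> R p (log 2 (real p) + 1) (C * real p)"
      using elim by (intro mono) (auto simp: n_def E_def)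
    with D(2)[OF elim(2)] show ?case by linarith
  qed
  have lower: "\<forall>\<^sub>F p in sequentially. 0 \<le> expectation (D p)"
    using eventually_ge_at_top[of 1] by eventually_elim (rule nonneg)
  have "(\<lambda>p. R p (log 2 (real p) + 1) (C * real p)) \<longlonglongrightarrow> 0"
    unfolding R_def a_def c_def r_def by (rule gap_bound_vanishes)
  then have "(\<lambda>p. expectation (D p)) \<longlonglongrightarrow> 0"
    by (rule tendsto_sandwich[OF lower upper tendsto_const])
  with D(1) show thesis
  proof (rule that)
    fix p \<omega> g m
    assume "p \<ge> 1" "\<bar>m\<bar> \<le> max_abs p (\<lambda>i. Y i \<omega>)"
    from D(3)[OF this]
    show "\<bar>URE F p (\<lambda>i. Y i \<omega>) g m - loss p (theta F) (shrinkage F (\<lambda>i. Y i \<omega>) g m)\<bar> \<le> D p \<omega>"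
      unfolding gap_def .
  qed
qed

end

section \<open>Comparing the minimizer with a competitor\<close>

lemma URE_mono_shrink_target:
  assumes "\<And>i. i \<in> {1..p} \<Longrightarrow> 0 < tau F i" "\<And>i. i \<in> {1..p} \<Longrightarrow> \<bar>y i - m'\<bar> \<le> \<bar>y i - m\<bar>"
  shows "URE F p y g m' \<le> URE F p y g m"
proof -
  have "URE F p y g x = (1 / real p) * (\<Sum>i=1..p. (shrink_weight F g i)\<^sup>2 * (y i - x)\<^sup>2
      + (1 - 2 * shrink_weight F g i) * ure_var F i (y i))" for x
    by (rule URE_eq_weight) (rule assms(1))
  then show ?thesis
    using assms(2) by (auto intro!: divide_right_mono mult_left_mono sum_mono simp: abs_le_square_iff)
qed

text \<open>
  The mean space is a closed interval that contains \<open>0\<close>, so the nearest point in it is no larger in modulus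
  and no farther from any point of the interval.
\<close>

lemma mean_space_projection:
  obtains m' where "\<bar>m'\<bar> \<le> \<bar>m\<bar>" "m' \<in> mean_space F" "\<And>y. y \<in> mean_space F \<Longrightarrow> \<bar>y - m'\<bar> \<le> \<bar>y - m\<bar>"
proof (cases F)
  case Binomial_fam
  then show thesis by (intro that[of "max 0 (min 1 m)"]) (auto simp: max_def min_def)
next
  case GHS_fam
  then show thesis by (intro that[of m]) auto
qed (intro that[of "max 0 m"]; simp add: max_def; linarith)+

text \<open>
  The competitor's target \<open>m'\<close> need not lie in the mean space over which \<open>m\<close> was optimized; its projection
  does, and has a value of \<open>URE\<close> that is no larger because all observations lie in the mean space.
\<close>

lemma URE_minimizer_le:
  assumes "URE_minimizer F p y g m" "\<bar>m'\<bar> \<le> max_abs p y"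
    and "\<And>i. i \<in> {1..p} \<Longrightarrow> 0 < tau F i" "\<And>i. i \<in> {1..p} \<Longrightarrow> y i \<in> mean_space F"
  shows "\<bar>m\<bar> \<le> max_abs p y" and "URE F p y g m \<le> URE F p y g' m'"
proof -
  show "\<bar>m\<bar> \<le> max_abs p y"
    using assms(1) by (simp add: URE_minimizer_def is_arg_min_def)
  obtain m'' where m'': "\<bar>m''\<bar> \<le> \<bar>m'\<bar>" "m'' \<in> mean_space F"
    "\<And>y. y \<in> mean_space F \<Longrightarrow> \<bar>y - m''\<bar> \<le> \<bar>y - m'\<bar>"
    using mean_space_projection[of m' F] by blast
  have "\<not> URE F p y g' m'' < URE F p y g m"
    using assms(1,2) m''(1,2) by (force simp: URE_minimizer_def is_arg_min_def)
  then have "URE F p y g m \<le> URE F p y g' m''" by simp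
  also have "\<dots> \<le> URE F p y g' m'"
    by (rule URE_mono_shrink_target) (use assms m'' in auto)
  finally show "URE F p y g m \<le> URE F p y g' m'" .
qed

context qvf_sample
begin

text \<open>
  The integral of a non-integrable function is \<open>0\<close> by convention, so risks can be compared only when both
  losses are integrable. An estimate lies between the observation and the target, and the target is
  controlled by the sum of the cubes of the observations.
\<close>

lemma integrable_loss:
  assumes "p \<ge> 1" and [measurable]: "g \<in> borel_measurable M" "m \<in> borel_measurable M"
    and m: "\<And>\<omega>. \<omega> \<in> space M \<Longrightarrow> \<bar>m \<omega>\<bar> \<le> max_abs p (\<lambda>i. Y i \<omega>)"
  shows "integrable M (\<lambda>\<omega>. loss p (theta F) (shrinkage F (\<lambda>i. Y i \<omega>) (g \<omega>) (m \<omega>)))"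
  unfolding loss_def
proof (intro integrable_mult_right Bochner_Integration.integrable_sum)
  fix i assume "i \<in> {1..p}"
  then have i: "i \<ge> 1" by simp
  let ?s = "\<lambda>\<omega>. shrinkage F (\<lambda>i. Y i \<omega>) (g \<omega>) (m \<omega>) i" and ?\<theta> = "theta F i"
  let ?B = "\<lambda>\<omega>. 2 * (Y i \<omega> - ?\<theta>)\<^sup>2 + 4 * (1 + (\<Sum>j=1..p. \<bar>Y j \<omega>\<bar> ^ 3)) + 4 * ?\<theta>\<^sup>2"
  show "integrable M (\<lambda>\<omega>. (?s \<omega> - ?\<theta>)\<^sup>2)"
  proof (rule Bochner_Integration.integrable_bound)
    show "integrable M ?B"
    proof (intro Bochner_Integration.integrable_add integrable_mult_right Bochner_Integration.integrable_sum integrable_const)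
      show "integrable M (\<lambda>\<omega>. (Y i \<omega> - ?\<theta>)\<^sup>2)" using var[OF i] by (simp add: has_bochner_integral_iff)
    qed (use third_moment(1) in auto)
    have "(\<lambda>\<omega>. (shrinkage F (\<lambda>i. Y i \<omega>) (g \<omega>) (m \<omega>) i - ?\<theta>)\<^sup>2) \<in> borel_measurable M"
      unfolding shrinkage_def using i by measurable
    then show "(\<lambda>\<omega>. (?s \<omega> - ?\<theta>)\<^sup>2) \<in> borel_measurable M" .
    show "AE \<omega> in M. norm ((?s \<omega> - ?\<theta>)\<^sup>2) \<le> norm (?B \<omega>)"
    proof (rule AE_I2)
      fix \<omega> assume \<omega>: "\<omega> \<in> space M"
      define b where "b = shrink_weight F (g \<omega>) i"
      have b: "0 \<le> b" "b \<le> 1" using shrink_weight_bounds[OF tau_pos[OF i], of "g \<omega>"] by (auto simp: b_def)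
      have m2: "(m \<omega>)\<^sup>2 \<le> 1 + (\<Sum>j=1..p. \<bar>Y j \<omega>\<bar> ^ 3)"
        using square_max_abs_le[OF _ assms(1) m[OF \<omega>], of 1] by simp
      have sq: "(x + z)\<^sup>2 \<le> 2 * x\<^sup>2 + 2 * z\<^sup>2" "(x - z)\<^sup>2 \<le> 2 * x\<^sup>2 + 2 * z\<^sup>2" for x z :: real
        using sum_squares_bound[of x z] sum_squares_bound[of x "- z"] by (auto simp: power2_sum power2_diff)
      have "?s \<omega> - ?\<theta> = (1 - b) * (Y i \<omega> - ?\<theta>) + b * (m \<omega> - ?\<theta>)"
        by (simp add: shrinkage_eq_weight[OF tau_pos[OF i]] b_def algebra_simps)
      then have "(?s \<omega> - ?\<theta>)\<^sup>2 \<le> 2 * ((1 - b)\<^sup>2 * (Y i \<omega> - ?\<theta>)\<^sup>2) + 2 * (b\<^sup>2 * (m \<omega> - ?\<theta>)\<^sup>2)"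
        using sq(1)[of "(1 - b) * (Y i \<omega> - ?\<theta>)" "b * (m \<omega> - ?\<theta>)"] by (simp add: power_mult_distrib)
      also have "\<dots> \<le> 2 * (Y i \<omega> - ?\<theta>)\<^sup>2 + 2 * (m \<omega> - ?\<theta>)\<^sup>2"
        using b by (intro add_mono mult_left_mono mult_left_le_one_le) (auto intro: power_le_one)
      also have "\<dots> \<le> ?B \<omega>"
        using sq(2)[of "m \<omega>" ?\<theta>] m2 by simp
      finally show "norm ((?s \<omega> - ?\<theta>)\<^sup>2) \<le> norm (?B \<omega>)" by simp
    qed
  qed
qed

end

lemma (in prob_space) dominated_excess_vanishes:
  fixes A B D :: "nat \<Rightarrow> 'a \<Rightarrow> real"
  assumes "\<And>p. p \<ge> 1 \<Longrightarrow> integrable M (A p)" "\<And>p. p \<ge> 1 \<Longrightarrow> integrable M (B p)"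
    and D: "\<And>p. p \<ge> 1 \<Longrightarrow> integrable M (D p)" and D0: "\<And>p \<omega>. p \<ge> 1 \<Longrightarrow> 0 \<le> D p \<omega>"
    and lim: "(\<lambda>p. expectation (D p)) \<longlonglongrightarrow> 0"
    and le: "\<And>p. p \<ge> 1 \<Longrightarrow> AE \<omega> in M. A p \<omega> \<le> B p \<omega> + D p \<omega>"
  shows "\<epsilon> > 0 \<Longrightarrow> (\<lambda>p. prob {\<omega> \<in> space M. A p \<omega> \<ge> B p \<omega> + \<epsilon>}) \<longlonglongrightarrow> 0"
    and "limsup (\<lambda>p. ereal (expectation (A p) - expectation (B p))) \<le> 0"
proof -
  assume \<epsilon>: "\<epsilon> > 0"
  show "(\<lambda>p. prob {\<omega> \<in> space M. A p \<omega> \<ge> B p \<omega> + \<epsilon>}) \<longlonglongrightarrow> 0"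
  proof (rule tendsto_sandwich[OF _ _ tendsto_const])
    show "\<forall>\<^sub>F p in sequentially. 0 \<le> prob {\<omega> \<in> space M. A p \<omega> \<ge> B p \<omega> + \<epsilon>}" by simp
    show "\<forall>\<^sub>F p in sequentially. prob {\<omega> \<in> space M. A p \<omega> \<ge> B p \<omega> + \<epsilon>} \<le> expectation (D p) / \<epsilon>"
      using eventually_ge_at_top[of 1]
    proof eventually_elim
      case (elim p)
      have [measurable]: "D p \<in> borel_measurable M" using D[OF elim] by simp
      have "prob {\<omega> \<in> space M. A p \<omega> \<ge> B p \<omega> + \<epsilon>} \<le> prob {\<omega> \<in> space M. \<epsilon> \<le> D p \<omega>}"
        using le[OF elim] by (intro finite_measure_mono_AE) (auto elim: eventually_mono)
      also have "\<dots> \<le> expectation (D p) / \<epsilon>"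
        by (rule integral_Markov_inequality_measure[where A = "{}"]) (use D[OF elim] D0[OF elim] \<epsilon> in auto)
      finally show ?case .
    qed
    show "(\<lambda>p. expectation (D p) / \<epsilon>) \<longlonglongrightarrow> 0"
      using tendsto_divide[OF lim tendsto_const[of \<epsilon>]] \<epsilon> by simp
  qed
next
  have "limsup (\<lambda>p. ereal (expectation (A p) - expectation (B p))) \<le> limsup (\<lambda>p. ereal (expectation (D p)))"
  proof (rule Limsup_mono)
    show "\<forall>\<^sub>F p in sequentially. ereal (expectation (A p) - expectation (B p)) \<le> ereal (expectation (D p))"
      using eventually_ge_at_top[of 1]
    proof eventually_elim
      case (elim p)
      have "expectation (A p) \<le> expectation (\<lambda>\<omega>. B p \<omega> + D p \<omega>)"
        by (rule integral_mono_AE) (use assms(1,2) D le elim in auto)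
      then show ?case using assms(2)[OF elim] D[OF elim] by simp
    qed
  qed
  also have "\<dots> = 0"
    using lim by (intro lim_imp_Limsup) (auto simp: zero_ereal_def)
  finally show "limsup (\<lambda>p. ereal (expectation (A p) - expectation (B p))) \<le> 0" .
qed

section \<open>Asymptotic optimality\<close>

theorem theorem4p7:
  fixes M :: "'a measure" and F :: nef_qvf
    and Y :: "nat \<Rightarrow> 'a \<Rightarrow> real"
    and \<gamma>PM \<gamma>hat :: "nat \<Rightarrow> 'a \<Rightarrow> ennreal"
    and \<mu>PM \<mu>hat :: "nat \<Rightarrow> 'a \<Rightarrow> real"
    and est_PM est :: "nat \<Rightarrow> 'a \<Rightarrow> nat \<Rightarrow> real"
  assumes "prob_space M"
    and "valid_params F"
    and "prob_space.indep_vars M (\<lambda>_. borel) Y {1..}"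
    and "\<forall>i\<ge>1. has_family_law M F i (Y i)"
    and "family_condition F"
    and "\<forall>p\<ge>1. \<gamma>PM p \<in> borel_measurable M \<and> \<mu>PM p \<in> borel_measurable M"
    and "\<forall>p\<ge>1. \<forall>\<omega>\<in>space M. URE_minimizer F p (\<lambda>i. Y i \<omega>) (\<gamma>PM p \<omega>) (\<mu>PM p \<omega>)"
    and "\<forall>p\<ge>1. \<gamma>hat p \<in> borel_measurable M \<and> \<mu>hat p \<in> borel_measurable M"
    and "\<forall>p\<ge>1. \<forall>\<omega>\<in>space M. \<bar>\<mu>hat p \<omega>\<bar> \<le> max_abs p (\<lambda>i. Y i \<omega>)"
    and "est_PM = (\<lambda>p \<omega>. shrinkage F (\<lambda>i. Y i \<omega>) (\<gamma>PM p \<omega>) (\<mu>PM p \<omega>))"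
    and "est = (\<lambda>p \<omega>. shrinkage F (\<lambda>i. Y i \<omega>) (\<gamma>hat p \<omega>) (\<mu>hat p \<omega>))"
  shows "(\<forall>\<epsilon>>0. (\<lambda>p. measure M {\<omega> \<in> space M.
            loss p (theta F) (est_PM p \<omega>) \<ge> loss p (theta F) (est p \<omega>) + \<epsilon>}) \<longlonglongrightarrow> 0)
       \<and> limsup (\<lambda>p. ereal (risk M p (theta F) (est_PM p) - risk M p (theta F) (est p))) \<le> 0"
proof -
  interpret prob_space M by fact
  note tau = valid_params_tau_pos[OF assms(2)]
  have law: "has_family_law M F i (Y i)" if "i \<ge> 1" for i using assms(4) that by blast
  obtain e C where e: "\<And>i. i \<ge> 1 \<Longrightarrow> 0 < tau F i + nu2 F \<and> moment_envelope F i (e i)"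
    and growth: "\<forall>\<^sub>F p in sequentially. (\<Sum>i=1..p. e i) \<le> C * real p"
    by (rule family_moment_envelope[OF assms(2,5)]) blast
  interpret qvf_sample M F Y e C
  proof unfold_locales
    fix i :: nat assume i: "i \<ge> 1"
    note moments = has_qvf_mgf_central_moments[OF family_mgf_and_support(1)[OF assms(2) law[OF i] i] tau[OF i]]
    show "has_bochner_integral M (\<lambda>\<omega>. Y i \<omega> - theta F i) 0" by (rule moments(1))
    show "has_bochner_integral M (\<lambda>\<omega>. (Y i \<omega> - theta F i)\<^sup>2) (Vfun F (theta F i) / tau F i)"
      by (rule moments(2))
    show "has_bochner_integral M (\<lambda>\<omega>. (Y i \<omega> - theta F i) ^ 4) (fourth_moment F i)" by (rule moments(3))
    show "0 < tau F i" by (rule tau[OF i])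
    show "0 < tau F i + nu2 F" "moment_envelope F i (e i)" using e[OF i] by auto
  qed (use assms(3) growth in auto)
  obtain D where D: "\<And>p. p \<ge> 1 \<Longrightarrow> integrable M (D p)" "(\<lambda>p. expectation (D p)) \<longlonglongrightarrow> 0"
    and gap: "\<And>p \<omega> g m. p \<ge> 1 \<Longrightarrow> \<bar>m\<bar> \<le> max_abs p (\<lambda>i. Y i \<omega>) \<Longrightarrow>
      \<bar>URE F p (\<lambda>i. Y i \<omega>) g m - loss p (theta F) (shrinkage F (\<lambda>i. Y i \<omega>) g m)\<bar> \<le> D p \<omega>"
    by (rule uniform_gap) blast
  have D_nonneg: "0 \<le> D p \<omega>" if "p \<ge> 1" for p \<omega>
  proof -
    have "\<bar>0\<bar> \<le> max_abs p (\<lambda>i. Y i \<omega>)"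
      using max_abs_ge[of 1 p "\<lambda>i. Y i \<omega>"] that by simp
    from gap[OF that this, of 0] show ?thesis by linarith
  qed
  have PM_abs: "\<bar>\<mu>PM p \<omega>\<bar> \<le> max_abs p (\<lambda>i. Y i \<omega>)" if "p \<ge> 1" "\<omega> \<in> space M" for p \<omega>
    using assms(7) that by (auto simp: URE_minimizer_def is_arg_min_def)
  have excess: "AE \<omega> in M. loss p (theta F) (est_PM p \<omega>) \<le> loss p (theta F) (est p \<omega>) + 2 * D p \<omega>"
    if p: "p \<ge> 1" for p
  proof -
    have "AE \<omega> in M. \<forall>i\<in>{1..p}. Y i \<omega> \<in> mean_space F"
      by (rule AE_finite_allI) (use family_mgf_and_support(2)[OF assms(2) law] in auto)
    then show ?thesis
      using AE_space
    proof eventually_elim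
      case (elim \<omega>)
      have hat: "\<bar>\<mu>hat p \<omega>\<bar> \<le> max_abs p (\<lambda>i. Y i \<omega>)"
        and min: "URE_minimizer F p (\<lambda>i. Y i \<omega>) (\<gamma>PM p \<omega>) (\<mu>PM p \<omega>)"
        using assms(7,9) p elim(2) by auto
      have "URE F p (\<lambda>i. Y i \<omega>) (\<gamma>PM p \<omega>) (\<mu>PM p \<omega>) \<le> URE F p (\<lambda>i. Y i \<omega>) (\<gamma>hat p \<omega>) (\<mu>hat p \<omega>)"
        by (rule URE_minimizer_le(2)[OF min hat]) (use tau elim(1) in auto)
      with gap[OF p PM_abs[OF p elim(2)], of "\<gamma>PM p \<omega>"] gap[OF p hat, of "\<gamma>hat p \<omega>"]
      show ?case unfolding assms(10,11) by linarith
    qed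
  qed
  have int: "integrable M (\<lambda>\<omega>. loss p (theta F) (est_PM p \<omega>))" "integrable M (\<lambda>\<omega>. loss p (theta F) (est p \<omega>))"
    if "p \<ge> 1" for p
    unfolding assms(10,11) using assms(6,8,9) PM_abs that by (auto intro!: integrable_loss)
  have lim: "(\<lambda>p. expectation (\<lambda>\<omega>. 2 * D p \<omega>)) \<longlonglongrightarrow> 0"
    using tendsto_mult_left[OF D(2), of 2] by simp
  have "\<And>p. p \<ge> 1 \<Longrightarrow> integrable M (\<lambda>\<omega>. 2 * D p \<omega>)" "\<And>p \<omega>. p \<ge> 1 \<Longrightarrow> 0 \<le> 2 * D p \<omega>"
    using D(1) D_nonneg by auto
  note concl = dominated_excess_vanishes[where A = "\<lambda>p \<omega>. loss p (theta F) (est_PM p \<omega>)"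
      and B = "\<lambda>p \<omega>. loss p (theta F) (est p \<omega>)", OF int this lim excess]
  show ?thesis
    unfolding risk_def using concl by blast
qed

end
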